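(* Suppose $\mu=0$ (i.e. $\psi$ is only assumed convex) and the iterates $\boldsymbol{x}_1,\dots,\boldsymbol{x}_{T+1}$ are produced by the General Proximal Gradient Method under the Random Reshuffle ($\mathsf{RR}$) sampling scheme, for arbitrary $T\in\mathbb{N}$. Let $\eta>0$. (1) If $\eta_t=\eta\,\frac{\mathsf{q}(T)-\mathsf{q}(t)+1}{\mathsf{q}(T)\sqrt{T}}$ for all $t\in[T]$, then for any $\boldsymbol{z}\in\mathbb{R}^d$, $$\mathbb{E}[F(\boldsymbol{x}_{T+1})-F(\boldsymbol{z})]\le O\left(\left(\frac{\|\boldsymbol{z}-\boldsymbol{x}_1\|^2}{\eta}+\eta\sqrt{n}\,G_{f,1}G_{f,2}\left(1+\frac{\log n}{\mathsf{q}(T)}\right)\right)\frac{1}{\sqrt{T}}\right).$$ Set $\eta=\frac{\|\boldsymbol{z}-\boldsymbol{x}_1\|}{n^{1/4}\sqrt{G_{f,1}G_{f,2}\left(1+\frac{\log n}{\mathsf{q}(T)}\right)}}$ to optimize the dependence on parameters. (2) If $\eta_t=\frac{\eta}{\sqrt{T}}$ for all $t\in[T]$, then for any $\boldsymbol{z}\in\mathbb{R}^d$, $$\mathbb{E}[F(\boldsymbol{x}_{T+1})-F(\boldsymbol{z})]\le O\left(\left(\frac{\|\boldsymbol{z}-\boldsymbol{x}_1\|^2}{\eta}+\eta\sqrt{n}\,G_{f,1}G_{f,2}(1+\log T)\right)\frac{1}{\sqrt{T}}\right).$$ Set $\eta=\frac{\|\boldsymbol{z}-\boldsymbol{x}_1\|}{n^{1/4}\sqrt{G_{f,1}G_{f,2}(1+\log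 T)}}$ to optimize the dependence on parameters. (3) If $\eta_t=\frac{\eta}{\sqrt{t}}$ for all $t\in[T]$, then for any $\boldsymbol{z}\in\mathbb{R}^d$, $$\mathbb{E}[F(\boldsymbol{x}_{T+1})-F(\boldsymbol{z})]\le O\left(\left(\frac{\|\boldsymbol{z}-\boldsymbol{x}_1\|^2}{\eta}+\eta\sqrt{n}\,G_{f,1}G_{f,2}(1+\log T)\right)\frac{1}{\sqrt{T}}\right).$$ Set $\eta=\frac{\|\boldsymbol{z}-\boldsymbol{x}_1\|}{n^{1/4}\sqrt{G_{f,1}G_{f,2}}}$ to optimize the dependence on parameters.
   Context: Notation: $\mathbb{N}=\{1,2,\dots\}$, $[m]=\{1,\dots,m\}$, $\|\cdot\|$ and $\langle\cdot,\cdot\rangle$ are the Euclidean norm and inner product on $\mathbb{R}^d$, $\overline{\mathbb{R}}=(-\infty,+\infty]$, $\mathrm{dom}\,h=\{\boldsymbol{x}:h(\boldsymbol{x})<+\infty\}$, $\partial h(\boldsymbol{x})$ is the convex subdifferential and $\nabla h(\boldsymbol{x})$ denotes an element of $\partial h(\boldsymbol{x})$. $O(\cdot)$ hides an absolute constant. Problem: $F=f+\psi$ with $f=\frac1n\sum_{i=1}^n f_i$, each $f_i:\mathbb{R}^d\to\mathbb{R}$ convex, and $\psi:\mathbb{R}^d\to\overline{\mathbb{R}}$ proper, closed and convex. Each $f_i$ is $G_i$-Lipschitz on $\mathrm{dom}\,\psi$ for some $G_i>0$. For every $i\in[n]$ and $\boldsymbol{x}\in\mathbb{R}^d$, $\nabla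 f_i(\boldsymbol{x})$ is deterministically picked from $\partial f_i(\boldsymbol{x})$. Put $G_{f,1}=\frac1n\sum_{i=1}^nG_i$ and $G_{f,2}=\sqrt{\frac1n\sum_{i=1}^nG_i^2}$. General Proximal Gradient Method: given an initial point $\boldsymbol{x}_1\in\mathrm{dom}\,\psi$ and stepsizes $\eta_t>0$, $t\in[T]$, for $t=1,\dots,T$ generate an index $\mathsf{i}(t)\in[n]$ and set $$\boldsymbol{x}_{t+1}=\mathrm{argmin}_{\boldsymbol{x}\in\mathbb{R}^d}\ \psi(\boldsymbol{x})+\langle\nabla f_{\mathsf{i}(t)}(\boldsymbol{x}_t),\boldsymbol{x}\rangle+\frac{\|\boldsymbol{x}-\boldsymbol{x}_t\|^2}{2\eta_t}.$$ For $t\in\mathbb{N}$, $\mathsf{q}(t)=\lceil t/n\rceil$ and $\mathsf{r}(t)=t-(\mathsf{q}(t)-1)n\in[n]$. $\mathsf{RR}$ sampling scheme: $\mathsf{i}(t)=\pi_{\mathsf{q}(t)}^{\mathsf{r}(t)}$ where $\pi_1,\dots,\pi_{\mathsf{q}(T)}$ are mutually independent uniformly random permutations of $[n]$, and $\pi^j$ denotes the $j$-th entry of $\pi$.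
   Formalization: Besides each f_i being G_i-Lipschitz on dom ψ, the formal statement assumes that the picked subgradients satisfy ‖∇f_i(x)‖ ≤ G_i for x in dom ψ; without this the claim fails when subgradients at boundary points of dom ψ are large. *)

theory Defs
  imports "HOL-Probability.Probability" "HOL-Combinatorics.Permutations"
begin

text \<open>
  The absolute constant in the result must not depend on the dimension, so the dimension \<open>d\<close>
  has to be a bound variable rather than a type. Points of $R^d$ are therefore functions
  \<open>nat \<Rightarrow> real\<close> that vanish from index \<open>d\<close> on: this is the carrier of the library's topology
  \<^term>\<open>Euclidean_space d\<close>. Subtraction of points is the library's pointwise subtraction.
\<close>

abbreviation Rd :: "nat \<Rightarrow> (nat \<Rightarrow> real) set" where
  "Rd d \<equiv> topspace (Euclidean_space d)"

definition ip :: "nat \<Rightarrow> (nat \<Rightarrow> real) \<Rightarrow> (nat \<Rightarrow> real) \<Rightarrow> real" where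
  "ip d x y = (\<Sum>j<d. x j * y j)"

definition nrm :: "nat \<Rightarrow> (nat \<Rightarrow> real) \<Rightarrow> real" where
  "nrm d x = L2_set x {..<d}"

definition convex_fun :: "nat \<Rightarrow> ((nat \<Rightarrow> real) \<Rightarrow> ereal) \<Rightarrow> bool" where
  "convex_fun d h \<longleftrightarrow>
     (\<forall>x\<in>Rd d. \<forall>y\<in>Rd d. \<forall>u\<in>{0..1::real}.
        h (\<lambda>j. (1 - u) * x j + u * y j) \<le> ereal (1 - u) * h x + ereal u * h y)"

definition proper_fun :: "nat \<Rightarrow> ((nat \<Rightarrow> real) \<Rightarrow> ereal) \<Rightarrow> bool" where
  "proper_fun d h \<longleftrightarrow> (\<forall>x\<in>Rd d. h x \<noteq> -\<infinity>) \<and> (\<exists>x\<in>Rd d. h x < \<infinity>)"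

definition closed_fun :: "nat \<Rightarrow> ((nat \<Rightarrow> real) \<Rightarrow> ereal) \<Rightarrow> bool" where
  "closed_fun d h \<longleftrightarrow>
     closedin (prod_topology (Euclidean_space d) euclideanreal)
       {(x, a). x \<in> Rd d \<and> h x \<le> ereal a}"

definition edom :: "nat \<Rightarrow> ((nat \<Rightarrow> real) \<Rightarrow> ereal) \<Rightarrow> (nat \<Rightarrow> real) set" where
  "edom d h = {x \<in> Rd d. h x < \<infinity>}"

definition subdiff :: "nat \<Rightarrow> ((nat \<Rightarrow> real) \<Rightarrow> real) \<Rightarrow> (nat \<Rightarrow> real) \<Rightarrow> (nat \<Rightarrow> real) set" where
  "subdiff d h x = {v \<in> Rd d. \<forall>y\<in>Rd d. h x + ip d v (y - x) \<le> h y}"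

text \<open>
  \<open>g i x\<close> is the subgradient of \<open>f i\<close> picked at \<open>x\<close>. Lipschitz continuity of \<open>f i\<close> on the domain
  of \<open>\<psi>\<close> is meant in the sense usual for subgradient methods, which includes that the subgradients
  used by the method at points of the domain are bounded by the Lipschitz constant. This is not a
  consequence of the inequality between function values when the domain has boundary points: for
  $\max(-Kx,0)$ on $[0,\infty)$ the values are constant, but $-K$ is a subgradient at \<open>0\<close>.
\<close>

locale composite_problem =
  fixes d n :: nat
    and f :: "nat \<Rightarrow> (nat \<Rightarrow> real) \<Rightarrow> real"
    and g :: "nat \<Rightarrow> (nat \<Rightarrow> real) \<Rightarrow> (nat \<Rightarrow> real)"
    and G :: "nat \<Rightarrow> real"
    and \<psi> :: "(nat \<Rightarrow> real) \<Rightarrow> ereal"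
  assumes dim_pos: "1 \<le> d"
    and n_pos: "1 \<le> n"
    and f_convex: "\<And>i. i \<in> {1..n} \<Longrightarrow> convex_fun d (\<lambda>x. ereal (f i x))"
    and psi_proper: "proper_fun d \<psi>"
    and psi_closed: "closed_fun d \<psi>"
    and psi_convex: "convex_fun d \<psi>"
    and G_pos: "\<And>i. i \<in> {1..n} \<Longrightarrow> 0 < G i"
    and g_subgradient: "\<And>i x. i \<in> {1..n} \<Longrightarrow> x \<in> Rd d \<Longrightarrow> g i x \<in> subdiff d (f i) x"
    and f_lipschitz: "\<And>i x y. i \<in> {1..n} \<Longrightarrow> x \<in> edom d \<psi> \<Longrightarrow> y \<in> edom d \<psi> \<Longrightarrow>
                        \<bar>f i x - f i y\<bar> \<le> G i * nrm d (x - y)"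
    and g_bounded: "\<And>i x. i \<in> {1..n} \<Longrightarrow> x \<in> edom d \<psi> \<Longrightarrow> nrm d (g i x) \<le> G i"

definition objective ::
  "nat \<Rightarrow> (nat \<Rightarrow> (nat \<Rightarrow> real) \<Rightarrow> real) \<Rightarrow> ((nat \<Rightarrow> real) \<Rightarrow> ereal) \<Rightarrow> (nat \<Rightarrow> real) \<Rightarrow> ereal" where
  "objective n f \<psi> x = ereal ((\<Sum>i=1..n. f i x) / real n) + \<psi> x"

definition Gf1 :: "nat \<Rightarrow> (nat \<Rightarrow> real) \<Rightarrow> real" where
  "Gf1 n G = (\<Sum>i=1..n. G i) / real n"

definition Gf2 :: "nat \<Rightarrow> (nat \<Rightarrow> real) \<Rightarrow> real" where
  "Gf2 n G = sqrt ((\<Sum>i=1..n. (G i)\<^sup>2) / real n)"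

text \<open>Times and components are numbered from \<open>1\<close>; values of \<open>x\<close> outside \<open>{1..T + 1}\<close> are irrelevant.\<close>

definition prox_grad_iterates ::
  "nat \<Rightarrow> nat \<Rightarrow> (nat \<Rightarrow> (nat \<Rightarrow> real) \<Rightarrow> (nat \<Rightarrow> real)) \<Rightarrow> ((nat \<Rightarrow> real) \<Rightarrow> ereal) \<Rightarrow>
   (nat \<Rightarrow> real) \<Rightarrow> (nat \<Rightarrow> nat) \<Rightarrow> (nat \<Rightarrow> real) \<Rightarrow> (nat \<Rightarrow> nat \<Rightarrow> real) \<Rightarrow> bool" where
  "prox_grad_iterates d T g \<psi> step idx x1 x \<longleftrightarrow>
     x 1 = x1 \<and>
     (\<forall>t\<in>{1..T}.
        is_arg_min
          (\<lambda>y. \<psi> y + ereal (ip d (g (idx t) (x t)) y) + ereal ((nrm d (y - x t))\<^sup>2 / (2 * step t)))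
          (\<lambda>y. y \<in> Rd d)
          (x (t + 1)))"

definition epoch :: "nat \<Rightarrow> nat \<Rightarrow> nat" where
  "epoch n t = nat \<lceil>real t / real n\<rceil>"

definition pos_in_epoch :: "nat \<Rightarrow> nat \<Rightarrow> nat" where
  "pos_in_epoch n t = t - (epoch n t - 1) * n"

text \<open>
  The joint law of independent uniformly random permutations \<open>\<omega> 1, \<dots>, \<omega> Q\<close> of \<open>{1..n}\<close>;
  \<open>\<omega> k j\<close> is the \<open>j\<close>-th entry of the \<open>k\<close>-th permutation.
\<close>

definition RR_pmf :: "nat \<Rightarrow> nat \<Rightarrow> (nat \<Rightarrow> nat \<Rightarrow> nat) pmf" where
  "RR_pmf n Q = Pi_pmf {1..Q} id (\<lambda>_. pmf_of_set {p. p permutes {1..n}})"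

definition RR_index :: "nat \<Rightarrow> (nat \<Rightarrow> nat \<Rightarrow> nat) \<Rightarrow> nat \<Rightarrow> nat" where
  "RR_index n \<omega> t = \<omega> (epoch n t) (pos_in_epoch n t)"

definition RR_iterates ::
  "nat \<Rightarrow> nat \<Rightarrow> nat \<Rightarrow> (nat \<Rightarrow> (nat \<Rightarrow> real) \<Rightarrow> (nat \<Rightarrow> real)) \<Rightarrow> ((nat \<Rightarrow> real) \<Rightarrow> ereal) \<Rightarrow>
   (nat \<Rightarrow> real) \<Rightarrow> (nat \<Rightarrow> real) \<Rightarrow> ((nat \<Rightarrow> nat \<Rightarrow> nat) \<Rightarrow> nat \<Rightarrow> nat \<Rightarrow> real) \<Rightarrow> bool" where
  "RR_iterates d n T g \<psi> step x1 X \<longleftrightarrow>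
     (\<forall>\<omega>\<in>set_pmf (RR_pmf n (epoch n T)).
        prox_grad_iterates d T g \<psi> step (RR_index n \<omega>) x1 (X \<omega>))"

text \<open>
  Expectation of an extended-real random variable: integral of the positive part minus integral of
  the negative part. In \<^typ>\<open>ereal\<close> we have \<open>\<infinity> - \<infinity> = \<infinity>\<close>, so an upper bound on the expectation
  is never satisfied merely because the expectation is undefined.
\<close>

definition ereal_expectation :: "'a measure \<Rightarrow> ('a \<Rightarrow> ereal) \<Rightarrow> ereal" where
  "ereal_expectation M Y =
     enn2ereal (\<integral>\<^sup>+\<omega>. e2ennreal (Y \<omega>) \<partial>M) - enn2ereal (\<integral>\<^sup>+\<omega>. e2ennreal (- Y \<omega>) \<partial>M)"

lemma ereal_expectation_integrable:
  assumes "integrable M Y"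
  shows "ereal_expectation M (\<lambda>\<omega>. ereal (Y \<omega>)) = ereal (\<integral>\<omega>. Y \<omega> \<partial>M)"
proof -
  have fin: "(\<integral>\<^sup>+\<omega>. ennreal (Y \<omega>) \<partial>M) < \<infinity>" "(\<integral>\<^sup>+\<omega>. ennreal (- Y \<omega>) \<partial>M) < \<infinity>"
    using assms unfolding real_integrable_def by (auto simp: less_top)
  then have "enn2ereal (\<integral>\<^sup>+\<omega>. ennreal (Y \<omega>) \<partial>M) = ereal (enn2real (\<integral>\<^sup>+\<omega>. ennreal (Y \<omega>) \<partial>M))"
    "enn2ereal (\<integral>\<^sup>+\<omega>. ennreal (- Y \<omega>) \<partial>M) = ereal (enn2real (\<integral>\<^sup>+\<omega>. ennreal (- Y \<omega>) \<partial>M))"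
    by (metis ennreal_enn2real enn2ereal_ennreal enn2real_nonneg infinity_ennreal_def)+
  then show ?thesis
    unfolding ereal_expectation_def real_lebesgue_integral_def[OF assms]
    by simp
qed

definition expected_gap ::
  "nat \<Rightarrow> nat \<Rightarrow> (nat \<Rightarrow> (nat \<Rightarrow> real) \<Rightarrow> real) \<Rightarrow> ((nat \<Rightarrow> real) \<Rightarrow> ereal) \<Rightarrow>
   ((nat \<Rightarrow> nat \<Rightarrow> nat) \<Rightarrow> nat \<Rightarrow> nat \<Rightarrow> real) \<Rightarrow> (nat \<Rightarrow> real) \<Rightarrow> ereal" where
  "expected_gap n T f \<psi> X z =
     ereal_expectation (measure_pmf (RR_pmf n (epoch n T)))
       (\<lambda>\<omega>. objective n f \<psi> (X \<omega> (T + 1)) - objective n f \<psi> z)"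

end

theory Submission
  imports Defs
begin

text \<open>
  Within an epoch the index used at time \<open>t\<close> is not independent of the current iterate, so the mean of
  \<open>f (i t)\<close> at the iterate differs from the mean of the average \<open>f_avg\<close> of the components. The proof
  bounds this bias by algorithmic stability. Exchanging the position \<open>r\<close> of \<open>t\<close> with a position \<open>j\<close> of
  the same permutation preserves the law of the orders (\<open>mean_exchange\<close>), so the bias is the average
  over \<open>j\<close> of the difference of \<open>f (i t)\<close> between the trajectories of two exchanged orders, hence at
  most an average of \<open>G (i t)\<close> times their distance (\<open>bias_le_exchange_distance\<close>).

  The proximal map is nonexpansive and subdifferentials are monotone, so a step \<open>h\<close> with equal
  components adds at most \<open>4 * h\<^sup>2 * (G i)\<^sup>2\<close> to the squared distance, and only the exchanged steps add
  to the distance itself (\<open>iterates_stable\<close>). After at most \<open>n\<close> steps the distance has order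
  \<open>h * sqrt n * Gf2 n G\<close>, and the bias at time \<open>t\<close> is at most \<open>9 * K * step t\<close> with
  \<open>K = sqrt n * Gf1 n G * Gf2 n G\<close> (\<open>sampling_bias\<close>). Two points are delicate. The factors \<open>G (i t)\<close> and
  the distance have to be decoupled to obtain the product of the two averages (\<open>mean_exchange_distance\<close>).
  For the steps \<open>\<eta> / sqrt t\<close>, whose first epoch contains steps much larger than the current one, the
  exchange with an early position \<open>j\<close> is expensive but rare, and averaging over \<open>j\<close> removes the
  excess.

  The same bound holds at every iterate up to time \<open>t + 1\<close>, so an earlier iterate can serve as the
  comparison point in the descent inequality although it depends on the order (\<open>mean_descent\<close>). Let \<open>W t\<close> be
  the sum of the steps from \<open>t\<close> to \<open>T\<close>. Comparing each iterate with all later ones bounds the gap at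
  the last iterate by
  \<open>(nrm d (z - x1))\<^sup>2 / (2 * W 1)\<close> plus the sum of \<open>20 * K * (step t)\<^sup>2 / W t\<close> (\<open>last_iterate_le\<close>,
  \<open>expected_gap_le\<close>). For the three step size rules these sums are elementary.
\<close>

section \<open>Euclidean geometry on coordinate functions\<close>

lemma nrm_sq: "(nrm d x)\<^sup>2 = ip d x x"
  by (simp add: nrm_def ip_def L2_set_def power2_eq_square sum_nonneg)

lemma nrm_nonneg [simp]: "0 \<le> nrm d x"
  by (simp add: nrm_def)

lemma ip_diff_left: "ip d (x - y) v = ip d x v - ip d y v"
  by (simp add: ip_def algebra_simps sum_subtractf)

lemma ip_diff_right: "ip d v (x - y) = ip d v x - ip d v y"
  by (simp add: ip_def algebra_simps sum_subtractf)

lemma ip_le: "ip d x y \<le> nrm d x * nrm d y"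
proof -
  have "ip d x y \<le> (\<Sum>j<d. \<bar>x j\<bar> * \<bar>y j\<bar>)"
    unfolding ip_def by (intro sum_mono) (metis abs_ge_self abs_mult)
  also have "\<dots> \<le> nrm d x * nrm d y"
    unfolding nrm_def by (rule L2_set_mult_ineq)
  finally show ?thesis .
qed

lemma ip_ge: "- (nrm d x * nrm d y) \<le> ip d x y"
proof -
  have "ip d (- x) y \<le> nrm d (- x) * nrm d y" by (rule ip_le)
  then show ?thesis by (simp add: ip_def nrm_def L2_set_def sum_negf)
qed

lemma nrm_minus_commute: "nrm d (x - y) = nrm d (y - x)"
  by (simp add: nrm_def L2_set_def power2_commute)

lemma nrm_diff_le: "nrm d (x - y) \<le> nrm d x + nrm d y"
proof -
  have "nrm d (x - y) = L2_set (\<lambda>j. x j + (- y) j) {..<d}"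
    unfolding nrm_def by (intro L2_set_cong) simp_all
  also have "\<dots> \<le> nrm d x + L2_set (- y) {..<d}"
    unfolding nrm_def by (rule L2_set_triangle_ineq)
  finally show ?thesis by (simp add: nrm_def L2_set_def)
qed

lemma Rd_iff: "x \<in> Rd d \<longleftrightarrow> (\<forall>j\<ge>d. x j = 0)"
  by (simp add: topspace_Euclidean_space)

lemma nrm_diff_eq_0:
  assumes "x \<in> Rd d" "y \<in> Rd d" "nrm d (x - y) = 0"
  shows "x = y"
proof
  fix j
  show "x j = y j"
  proof (cases "j < d")
    case True
    then show ?thesis
      using assms(3) by (simp add: nrm_def L2_set_eq_0_iff)
  next
    case False
    then show ?thesis using assms by (simp add: Rd_iff)
  qed
qed

lemma nrm_sq_convex_combination:
  "(nrm d ((\<lambda>j. (1 - u) * a j + u * b j) - x))\<^sup>2 =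
     (1 - u) * (nrm d (a - x))\<^sup>2 + u * (nrm d (b - x))\<^sup>2 - u * (1 - u) * (nrm d (b - a))\<^sup>2"
  unfolding nrm_sq ip_def sum_distrib_left sum.distrib[symmetric] sum_subtractf[symmetric]
  by (intro sum.cong refl) (simp add: algebra_simps)

lemma ip_convex_combination:
  "ip d v (\<lambda>j. (1 - u) * a j + u * b j) = (1 - u) * ip d v a + u * ip d v b"
  unfolding ip_def sum_distrib_left sum.distrib[symmetric]
  by (intro sum.cong refl) (simp add: algebra_simps)

section \<open>One proximal step\<close>

text \<open>Compare \<open>w\<close> with the point that divides the segment from \<open>w\<close> to \<open>y\<close> in the ratio \<open>u\<close> to \<open>1 - u\<close>.
  The strong convexity of the quadratic term leaves \<open>1 - u\<close> times the squared distance, and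
  \<open>u\<close> tends to \<open>0\<close>.\<close>

lemma prox_three_point:
  assumes cvx: "convex_fun d \<psi>"
    and proper: "\<And>x. x \<in> Rd d \<Longrightarrow> \<psi> x \<noteq> - \<infinity>"
    and h: "0 < h"
    and min: "is_arg_min (\<lambda>y. \<psi> y + ereal (ip d v y) + ereal ((nrm d (y - x))\<^sup>2 / (2 * h)))
                (\<lambda>y. y \<in> Rd d) w"
    and y: "y \<in> edom d \<psi>"
  shows "w \<in> edom d \<psi>"
    and "real_of_ereal (\<psi> w) + ip d v w + (nrm d (w - x))\<^sup>2 / (2 * h) + (nrm d (y - w))\<^sup>2 / (2 * h)
          \<le> real_of_ereal (\<psi> y) + ip d v y + (nrm d (y - x))\<^sup>2 / (2 * h)"
proof -
  let ?p = "\<lambda>x. real_of_ereal (\<psi> x)"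
  let ?L = "\<lambda>y. \<psi> y + ereal (ip d v y) + ereal ((nrm d (y - x))\<^sup>2 / (2 * h))"
  have wR: "w \<in> Rd d" and le: "\<And>y. y \<in> Rd d \<Longrightarrow> ?L w \<le> ?L y"
    using min unfolding is_arg_min_linorder by auto
  have yR: "y \<in> Rd d" and yfin: "\<psi> y < \<infinity>" using y by (auto simp: edom_def)
  have py: "\<psi> y = ereal (?p y)"
    using yfin proper[OF yR] by (cases "\<psi> y") auto
  have "?L y < \<infinity>" using yfin by simp
  with le[OF yR] have "?L w < \<infinity>" by (rule le_less_trans)
  then have wfin: "\<psi> w < \<infinity>" by auto
  then show "w \<in> edom d \<psi>" using wR by (simp add: edom_def)
  have pw: "\<psi> w = ereal (?p w)"
    using wfin proper[OF wR] by (cases "\<psi> w") auto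
  let ?q = "(nrm d (y - w))\<^sup>2 / (2 * h)"
  let ?a = "ip d v w + (nrm d (w - x))\<^sup>2 / (2 * h)"
  let ?b = "ip d v y + (nrm d (y - x))\<^sup>2 / (2 * h)"
  have "?q \<le> (?p y + ?b) - (?p w + ?a)"
  proof (rule field_le_mult_one_interval)
    fix z :: real assume z: "0 < z" "z < 1"
    define u where "u = 1 - z"
    have u: "0 < u" "u < 1" using z by (auto simp: u_def)
    let ?c = "\<lambda>j. (1 - u) * w j + u * y j"
    have cR: "?c \<in> Rd d" using wR yR by (simp add: Rd_iff)
    have "\<psi> ?c \<le> ereal (1 - u) * \<psi> w + ereal u * \<psi> y"
      using cvx wR yR u unfolding convex_fun_def by auto
    also have "\<dots> = ereal ((1 - u) * ?p w + u * ?p y)"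
      by (subst pw, subst py) simp
    finally have c1: "\<psi> ?c \<le> ereal ((1 - u) * ?p w + u * ?p y)" .
    have "?L w \<le> ?L ?c" by (rule le[OF cR])
    also have "\<dots> \<le> ereal ((1 - u) * ?p w + u * ?p y) + ereal (ip d v ?c)
        + ereal ((nrm d (?c - x))\<^sup>2 / (2 * h))"
      by (intro add_right_mono c1)
    finally have fin: "?p w + ?a \<le> (1 - u) * ?p w + u * ?p y + ip d v ?c + (nrm d (?c - x))\<^sup>2 / (2 * h)"
      by (subst (asm) pw) (simp add: add.assoc)
    also have "\<dots> = (1 - u) * (?p w + ?a) + u * (?p y + ?b) - u * ((1 - u) * ?q)"
      unfolding ip_convex_combination nrm_sq_convex_combination
      by (simp add: add_divide_distrib diff_divide_distrib algebra_simps)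
    finally have fin: "?p w + ?a \<le> (1 - u) * (?p w + ?a) + u * (?p y + ?b) - u * ((1 - u) * ?q)" .
    have "u * Q \<le> u * (B - A)" if "A \<le> (1 - u) * A + u * B - u * Q" for A B Q
      using that by (simp add: algebra_simps)
    from this[OF fin] have "u * ((1 - u) * ?q) \<le> u * ((?p y + ?b) - (?p w + ?a))" .
    then have "(1 - u) * ?q \<le> (?p y + ?b) - (?p w + ?a)"
      using u by (simp only: mult_le_cancel_left_pos)
    then show "z * ?q \<le> (?p y + ?b) - (?p w + ?a)" by (simp add: u_def)
  qed
  then show "?p w + ip d v w + (nrm d (w - x))\<^sup>2 / (2 * h) + ?q
          \<le> ?p y + ip d v y + (nrm d (y - x))\<^sup>2 / (2 * h)"
    by simp
qed

text \<open>Adding the three-point inequalities of the two minimisers, each tested at the other one, leaves an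
  inner product to which the Cauchy-Schwarz inequality applies.\<close>

lemma prox_nonexpansive:
  assumes cvx: "convex_fun d \<psi>"
    and proper: "\<And>x. x \<in> Rd d \<Longrightarrow> \<psi> x \<noteq> - \<infinity>"
    and h: "0 < h"
    and min: "is_arg_min (\<lambda>y. \<psi> y + ereal (ip d v y) + ereal ((nrm d (y - x))\<^sup>2 / (2 * h)))
                (\<lambda>y. y \<in> Rd d) w"
    and min': "is_arg_min (\<lambda>y. \<psi> y + ereal (ip d v' y) + ereal ((nrm d (y - x'))\<^sup>2 / (2 * h)))
                (\<lambda>y. y \<in> Rd d) w'"
    and ne: "edom d \<psi> \<noteq> {}"
  shows "nrm d (w - w') \<le> nrm d ((x - x') - (\<lambda>j. h * (v - v') j))"
proof -
  obtain y0 where y0: "y0 \<in> edom d \<psi>" using ne by auto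
  have w: "w \<in> edom d \<psi>" and w': "w' \<in> edom d \<psi>"
    using prox_three_point(1)[OF cvx proper h min y0] prox_three_point(1)[OF cvx proper h min' y0] by auto
  note 1 = prox_three_point(2)[OF cvx proper h min w']
  note 2 = prox_three_point(2)[OF cvx proper h min' w]
  have s: "ip d (v - v') (w - w') + (nrm d (w - w'))\<^sup>2 / h
      + ((nrm d (w - x))\<^sup>2 + (nrm d (w' - x'))\<^sup>2 - (nrm d (w' - x))\<^sup>2 - (nrm d (w - x'))\<^sup>2) / (2 * h) \<le> 0"
  proof -
    have "(nrm d (w - w'))\<^sup>2 / h = 2 * ((nrm d (w - w'))\<^sup>2 / (2 * h))" by simp
    then show ?thesis
      using 1 2 unfolding nrm_minus_commute[of d w' w] ip_diff_left ip_diff_right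
        add_divide_distrib diff_divide_distrib by linarith
  qed
  have c: "(nrm d (w - x))\<^sup>2 + (nrm d (w' - x'))\<^sup>2 - (nrm d (w' - x))\<^sup>2 - (nrm d (w - x'))\<^sup>2
      = - 2 * ip d (x - x') (w - w')"
    unfolding nrm_sq ip_def sum_distrib_left sum.distrib[symmetric] sum_subtractf[symmetric]
    by (intro sum.cong refl) (simp add: algebra_simps)
  let ?e = "(x - x') - (\<lambda>j. h * (v - v') j)"
  have e: "ip d ?e (w - w') = ip d (x - x') (w - w') - h * ip d (v - v') (w - w')"
    unfolding ip_def sum_distrib_left sum_subtractf[symmetric]
    by (intro sum.cong refl) (simp add: algebra_simps)
  have "h * ip d (v - v') (w - w') + (nrm d (w - w'))\<^sup>2 - ip d (x - x') (w - w') \<le> 0"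
  proof -
    have "ip d (v - v') (w - w') + ((nrm d (w - w'))\<^sup>2 - ip d (x - x') (w - w')) / h \<le> 0"
      using s h unfolding c by (simp add: diff_divide_distrib)
    from mult_left_mono[OF this, of h] show ?thesis using h by (simp add: distrib_left)
  qed
  then have "(nrm d (w - w'))\<^sup>2 \<le> ip d ?e (w - w')"
    unfolding e by simp
  also have "\<dots> \<le> nrm d ?e * nrm d (w - w')" by (rule ip_le)
  finally have "nrm d (w - w') * nrm d (w - w') \<le> nrm d ?e * nrm d (w - w')"
    by (simp only: power2_eq_square)
  then show ?thesis
    using nrm_nonneg[of d "w - w'"] nrm_nonneg[of d ?e] by (cases "nrm d (w - w') = 0") auto
qed

section \<open>Trajectories of the method\<close>

text \<open>The step of the induction in the stability bound: squared growth enters under the root, so that the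
  linear part \<open>D\<close> is not multiplied by later steps.\<close>

lemma sqrt_plus_const_growth:
  fixes u v S D c :: real
  assumes "u\<^sup>2 \<le> v\<^sup>2 + 4 * c" "v \<le> 2 * sqrt S + D" "0 \<le> v" "0 \<le> S" "0 \<le> c" "0 \<le> D"
  shows "u \<le> 2 * sqrt (S + c) + D"
proof (rule power2_le_imp_le)
  have "v\<^sup>2 \<le> (2 * sqrt S + D)\<^sup>2" using assms by (intro power_mono) auto
  also have "\<dots> = 4 * S + 4 * (D * sqrt S) + D\<^sup>2"
    using assms by (simp add: power2_sum power_mult_distrib)
  finally have "u\<^sup>2 \<le> 4 * (S + c) + 4 * (D * sqrt S) + D\<^sup>2" using assms(1) by simp
  also have "D * sqrt S \<le> D * sqrt (S + c)"
    using assms by (intro mult_left_mono) auto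
  also have "4 * (S + c) + 4 * (D * sqrt (S + c)) + D\<^sup>2 = (2 * sqrt (S + c) + D)\<^sup>2"
    using assms by (simp add: power2_sum power_mult_distrib)
  finally show "u\<^sup>2 \<le> (2 * sqrt (S + c) + D)\<^sup>2" by simp
qed (use assms in auto)

context composite_problem
begin

definition psi_val :: "(nat \<Rightarrow> real) \<Rightarrow> real" where
  "psi_val x = real_of_ereal (\<psi> x)"

lemma psi_not_MInf: "x \<in> Rd d \<Longrightarrow> \<psi> x \<noteq> - \<infinity>"
  using psi_proper by (simp add: proper_fun_def)

lemma edom_Rd: "x \<in> edom d \<psi> \<Longrightarrow> x \<in> Rd d"
  by (simp add: edom_def)

lemma psi_val: "x \<in> edom d \<psi> \<Longrightarrow> \<psi> x = ereal (psi_val x)"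
  using psi_not_MInf[of x] unfolding psi_val_def by (cases "\<psi> x") (auto simp: edom_def)

lemma subgradient_le:
  assumes "i \<in> {1..n}" "x \<in> Rd d" "y \<in> Rd d"
  shows "f i x + ip d (g i x) (y - x) \<le> f i y"
  using g_subgradient[OF assms(1,2)] assms(3) unfolding subdiff_def by auto

text \<open>Replacing \<open>f i x\<close> by \<open>f i w\<close> costs a multiple of \<open>nrm d (w - x)\<close>, which the term
  \<open>- (nrm d (w - x))\<^sup>2 / (2 * h)\<close> of the three-point inequality absorbs.\<close>

lemma prox_step_descent:
  assumes i: "i \<in> {1..n}" and h: "0 < h"
    and x: "x \<in> edom d \<psi>" and y: "y \<in> edom d \<psi>"
    and min: "is_arg_min (\<lambda>y. \<psi> y + ereal (ip d (g i x) y) + ereal ((nrm d (y - x))\<^sup>2 / (2 * h)))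
                (\<lambda>y. y \<in> Rd d) w"
  shows "h * ((f i w + psi_val w) - (f i y + psi_val y))
           \<le> ((nrm d (y - x))\<^sup>2 - (nrm d (y - w))\<^sup>2) / 2 + 2 * h\<^sup>2 * (G i)\<^sup>2"
proof -
  let ?s = "nrm d (w - x)"
  have w: "w \<in> edom d \<psi>"
    using prox_three_point(1)[OF psi_convex psi_not_MInf h min y] .
  have 1: "psi_val w + ip d (g i x) w + ?s\<^sup>2 / (2 * h) + (nrm d (y - w))\<^sup>2 / (2 * h)
          \<le> psi_val y + ip d (g i x) y + (nrm d (y - x))\<^sup>2 / (2 * h)"
    using prox_three_point(2)[OF psi_convex psi_not_MInf h min y] unfolding psi_val_def .
  have 2: "f i x + ip d (g i x) (y - x) \<le> f i y"
    using subgradient_le[OF i edom_Rd[OF x] edom_Rd[OF y]] .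
  have 3: "f i w - f i x \<le> G i * ?s"
    using f_lipschitz[OF i w x] by linarith
  have "nrm d (g i x) * ?s \<le> G i * ?s"
    using g_bounded[OF i x] by (intro mult_right_mono) auto
  then have 4: "- (G i * ?s) \<le> ip d (g i x) (w - x)"
    using ip_ge[of d "g i x" "w - x"] by linarith
  have 5: "(f i w + psi_val w) - (f i y + psi_val y)
      \<le> (nrm d (y - x))\<^sup>2 / (2 * h) - (nrm d (y - w))\<^sup>2 / (2 * h) + (2 * (G i * ?s) - ?s\<^sup>2 / (2 * h))"
    using 1 2 3 4 unfolding ip_diff_right by linarith
  have "h * ((f i w + psi_val w) - (f i y + psi_val y))
      \<le> h * ((nrm d (y - x))\<^sup>2 / (2 * h) - (nrm d (y - w))\<^sup>2 / (2 * h) + (2 * (G i * ?s) - ?s\<^sup>2 / (2 * h)))"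
    using 5 h by (intro mult_left_mono) auto
  also have "\<dots> = ((nrm d (y - x))\<^sup>2 - (nrm d (y - w))\<^sup>2) / 2 + (2 * h * (G i * ?s) - ?s\<^sup>2 / 2)"
    using h by (simp add: field_simps)
  also have "\<dots> \<le> ((nrm d (y - x))\<^sup>2 - (nrm d (y - w))\<^sup>2) / 2 + 2 * h\<^sup>2 * (G i)\<^sup>2"
  proof -
    have "2 * h * (G i * ?s) - ?s\<^sup>2 / 2 \<le> 2 * h\<^sup>2 * (G i)\<^sup>2"
      using zero_le_power2[of "2 * h * G i - ?s"] by (simp add: power2_eq_square algebra_simps)
    then show ?thesis by linarith
  qed
  finally show ?thesis .
qed

text \<open>With equal components the monotonicity of the subdifferential gives only
  \<open>4 * h\<^sup>2 * (G i)\<^sup>2\<close> of growth for the squared distance; this is what makes nonsmooth trajectories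
  separate at the rate of a square root.\<close>

lemma prox_step_stable_same:
  assumes i: "i \<in> {1..n}" and h: "0 < h"
    and x: "x \<in> edom d \<psi>" and x': "x' \<in> edom d \<psi>"
    and min: "is_arg_min (\<lambda>y. \<psi> y + ereal (ip d (g i x) y) + ereal ((nrm d (y - x))\<^sup>2 / (2 * h)))
                (\<lambda>y. y \<in> Rd d) w"
    and min': "is_arg_min (\<lambda>y. \<psi> y + ereal (ip d (g i x') y) + ereal ((nrm d (y - x'))\<^sup>2 / (2 * h)))
                (\<lambda>y. y \<in> Rd d) w'"
  shows "(nrm d (w - w'))\<^sup>2 \<le> (nrm d (x - x'))\<^sup>2 + 4 * h\<^sup>2 * (G i)\<^sup>2"
proof -
  let ?v = "g i x - g i x'"
  have ne: "edom d \<psi> \<noteq> {}" using x by auto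
  have "nrm d (w - w') \<le> nrm d ((x - x') - (\<lambda>j. h * ?v j))"
    by (rule prox_nonexpansive[OF psi_convex psi_not_MInf h min min' ne])
  then have "(nrm d (w - w'))\<^sup>2 \<le> (nrm d ((x - x') - (\<lambda>j. h * ?v j)))\<^sup>2"
    by (intro power_mono) auto
  also have "\<dots> = (nrm d (x - x'))\<^sup>2 - 2 * h * ip d ?v (x - x') + h\<^sup>2 * (nrm d ?v)\<^sup>2"
    unfolding nrm_sq ip_def sum_distrib_left sum.distrib[symmetric] sum_subtractf[symmetric]
    by (intro sum.cong refl) (simp add: algebra_simps power2_eq_square)
  also have "\<dots> \<le> (nrm d (x - x'))\<^sup>2 + 4 * h\<^sup>2 * (G i)\<^sup>2"
  proof -
    have "f i x + ip d (g i x) (x' - x) \<le> f i x'" "f i x' + ip d (g i x') (x - x') \<le> f i x"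
      using subgradient_le[OF i edom_Rd edom_Rd] x x' by auto
    then have "0 \<le> ip d ?v (x - x')" unfolding ip_diff_left ip_diff_right by linarith
    then have a: "0 \<le> 2 * h * ip d ?v (x - x')" using h by simp
    have "nrm d ?v \<le> 2 * G i"
      using nrm_diff_le[of d "g i x" "g i x'"] g_bounded[OF i x] g_bounded[OF i x'] by linarith
    then have "(nrm d ?v)\<^sup>2 \<le> (2 * G i)\<^sup>2" by (intro power_mono) auto
    then have "h\<^sup>2 * (nrm d ?v)\<^sup>2 \<le> h\<^sup>2 * (2 * G i)\<^sup>2" by (intro mult_left_mono) auto
    with a show ?thesis by (simp add: power_mult_distrib)
  qed
  finally show ?thesis .
qed

lemma prox_step_stable_different:
  assumes i: "i \<in> {1..n}" and i': "i' \<in> {1..n}" and h: "0 < h"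
    and x: "x \<in> edom d \<psi>" and x': "x' \<in> edom d \<psi>"
    and min: "is_arg_min (\<lambda>y. \<psi> y + ereal (ip d (g i x) y) + ereal ((nrm d (y - x))\<^sup>2 / (2 * h)))
                (\<lambda>y. y \<in> Rd d) w"
    and min': "is_arg_min (\<lambda>y. \<psi> y + ereal (ip d (g i' x') y) + ereal ((nrm d (y - x'))\<^sup>2 / (2 * h)))
                (\<lambda>y. y \<in> Rd d) w'"
  shows "nrm d (w - w') \<le> nrm d (x - x') + h * (G i + G i')"
proof -
  let ?v = "g i x - g i' x'"
  have ne: "edom d \<psi> \<noteq> {}" using x by auto
  have "nrm d (w - w') \<le> nrm d ((x - x') - (\<lambda>j. h * ?v j))"
    by (rule prox_nonexpansive[OF psi_convex psi_not_MInf h min min' ne])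
  also have "\<dots> \<le> nrm d (x - x') + nrm d (\<lambda>j. h * ?v j)" by (rule nrm_diff_le)
  also have "\<dots> \<le> nrm d (x - x') + h * (G i + G i')"
  proof -
    have "nrm d (\<lambda>j. h * ?v j) = h * nrm d ?v"
      unfolding nrm_def using h by (subst L2_set_right_distrib) auto
    moreover have "nrm d ?v \<le> G i + G i'"
      using nrm_diff_le[of d "g i x" "g i' x'"] g_bounded[OF i x] g_bounded[OF i' x'] by linarith
    ultimately show ?thesis using h by simp
  qed
  finally show ?thesis .
qed

lemma iterates_edom:
  assumes it: "prox_grad_iterates d T g \<psi> step idx x1 x"
    and step: "\<And>t. t \<in> {1..T} \<Longrightarrow> 0 < step t"
    and x1: "x1 \<in> edom d \<psi>"
    and s: "s \<in> {1..T + 1}"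
  shows "x s \<in> edom d \<psi>"
proof (cases "s = 1")
  case True
  then show ?thesis using it x1 by (simp add: prox_grad_iterates_def)
next
  case False
  then obtain t where t: "s = t + 1" "t \<in> {1..T}" using s by (cases s) auto
  from it t(2) have
    "is_arg_min (\<lambda>y. \<psi> y + ereal (ip d (g (idx t) (x t)) y) + ereal ((nrm d (y - x t))\<^sup>2 / (2 * step t)))
       (\<lambda>y. y \<in> Rd d) (x (t + 1))"
    unfolding prox_grad_iterates_def by blast
  from prox_three_point(1)[OF psi_convex psi_not_MInf step[OF t(2)] this x1] t(1)
  show ?thesis by simp
qed

lemma iterates_coincide:
  assumes it: "prox_grad_iterates d T g \<psi> step idx x1 x"
    and it': "prox_grad_iterates d T g \<psi> step idx' x1 x'"
    and step: "\<And>t. t \<in> {1..T} \<Longrightarrow> 0 < step t"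
    and x1: "x1 \<in> edom d \<psi>"
    and before: "\<And>t. 1 \<le> t \<Longrightarrow> t < s \<Longrightarrow> idx t = idx' t"
    and s: "1 \<le> s" "s \<le> T + 1"
  shows "x s = x' s"
  using s before
proof (induction s rule: dec_induct)
  case base
  then show ?case using it it' by (simp add: prox_grad_iterates_def)
next
  case (step t)
  then have eq: "x t = x' t" and ieq: "idx t = idx' t" and t: "t \<in> {1..T}" by auto
  note m = it[unfolded prox_grad_iterates_def, THEN conjunct2, rule_format, OF t]
  note m' = it'[unfolded prox_grad_iterates_def, THEN conjunct2, rule_format, OF t, folded eq ieq]
  have "nrm d (x (t + 1) - x' (t + 1)) \<le> nrm d ((x t - x t) -
      (\<lambda>j. step t * (g (idx t) (x t) - g (idx t) (x t)) j))"
    using x1 by (intro prox_nonexpansive[OF psi_convex psi_not_MInf assms(3)[OF t] m m']) auto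
  also have "\<dots> = 0" by (simp add: nrm_def L2_set_def)
  finally have "nrm d (x (t + 1) - x' (t + 1)) = 0"
    using nrm_nonneg[of d "x (t + 1) - x' (t + 1)"] by linarith
  moreover have "x (t + 1) \<in> Rd d" "x' (t + 1) \<in> Rd d"
    using m m' by (auto simp: is_arg_min_def)
  ultimately show ?case using nrm_diff_eq_0 by simp
qed

text \<open>The sums start only at a time \<open>a\<close> before which the components agree. Summing from the
  beginning would charge the large early steps of a decreasing step size rule to every exchange and
  lose a logarithmic factor.\<close>

lemma iterates_stable:
  assumes it: "prox_grad_iterates d T g \<psi> step idx x1 x"
    and it': "prox_grad_iterates d T g \<psi> step idx' x1 x'"
    and step: "\<And>t. t \<in> {1..T} \<Longrightarrow> 0 < step t"
    and x1: "x1 \<in> edom d \<psi>"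
    and idx: "\<And>t. t \<in> {1..T} \<Longrightarrow> idx t \<in> {1..n}" "\<And>t. t \<in> {1..T} \<Longrightarrow> idx' t \<in> {1..n}"
    and before: "\<And>t. 1 \<le> t \<Longrightarrow> t < a \<Longrightarrow> idx t = idx' t" and a: "1 \<le> a"
    and outside: "\<And>t. t \<in> {1..T} \<Longrightarrow> t \<notin> D \<Longrightarrow> idx t = idx' t"
    and s: "1 \<le> s" "s \<le> T + 1"
  shows "nrm d (x s - x' s) \<le> 2 * sqrt (\<Sum>t\<in>{a..<s} - D. (step t)\<^sup>2 * (G (idx t))\<^sup>2)
           + (\<Sum>t\<in>{a..<s} \<inter> D. step t * (G (idx t) + G (idx' t)))"
proof (cases "s \<le> a")
  case True
  then have "x s = x' s" using before s
    by (intro iterates_coincide[OF it it' step x1]) auto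
  then show ?thesis using True by (simp add: nrm_def L2_set_def)
next
  case False
  then have "a \<le> s" by simp
  then show ?thesis using s(2)
  proof (induction s rule: dec_induct)
    case base
    have "x a = x' a" using before a base
      by (intro iterates_coincide[OF it it' step x1]) auto
    then show ?case by (simp add: nrm_def L2_set_def)
  next
    case (step s)
    then have t: "s \<in> {1..T}" using a by auto
    note m = it[unfolded prox_grad_iterates_def, THEN conjunct2, rule_format, OF t]
    note m' = it'[unfolded prox_grad_iterates_def, THEN conjunct2, rule_format, OF t]
    note h = assms(3)[OF t]
    have xd: "x s \<in> edom d \<psi>" "x' s \<in> edom d \<psi>"
      using iterates_edom[OF it assms(3) x1, of s] iterates_edom[OF it' assms(3) x1, of s] t by auto
    let ?S = "\<lambda>s. \<Sum>t\<in>{a..<s} - D. (step t)\<^sup>2 * (G (idx t))\<^sup>2"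
    let ?D = "\<lambda>s. \<Sum>t\<in>{a..<s} \<inter> D. step t * (G (idx t) + G (idx' t))"
    have IH: "nrm d (x s - x' s) \<le> 2 * sqrt (?S s) + ?D s" 
      by (rule step.IH) (use step.prems in simp)
    have ins: "{a..<Suc s} = insert s {a..<s}" using step by auto
    show ?case
    proof (cases "s \<in> D")
      case True
      have "nrm d (x (s + 1) - x' (s + 1)) \<le> nrm d (x s - x' s) + step s * (G (idx s) + G (idx' s))"
        by (rule prox_step_stable_different[OF idx(1)[OF t] idx(2)[OF t] h xd m m'])
      moreover have "?S (Suc s) = ?S s" "?D (Suc s) = ?D s + step s * (G (idx s) + G (idx' s))"
        using True by (simp_all add: ins Int_insert_left)
      ultimately show ?thesis using IH by (simp add: fun_diff_def)
    next
      case False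
      then have ieq: "idx' s = idx s" using outside[OF t] by simp
      have 1: "(nrm d (x (s + 1) - x' (s + 1)))\<^sup>2 \<le> (nrm d (x s - x' s))\<^sup>2
          + 4 * (step s)\<^sup>2 * (G (idx s))\<^sup>2"
        by (rule prox_step_stable_same[OF idx(1)[OF t] h xd m m'[unfolded ieq]])
      have 2: "?S (Suc s) = ?S s + (step s)\<^sup>2 * (G (idx s))\<^sup>2" "?D (Suc s) = ?D s"
        using False by (simp_all add: ins Int_insert_left insert_Diff_if)
      have D0: "0 \<le> ?D s"
      proof (intro sum_nonneg mult_nonneg_nonneg add_nonneg_nonneg)
        fix t assume "t \<in> {a..<s} \<inter> D"
        then have t: "t \<in> {1..T}" using a \<open>s \<in> {1..T}\<close> by auto
        show "0 \<le> step t" "0 \<le> G (idx t)" "0 \<le> G (idx' t)"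
          using assms(3)[OF t] G_pos[OF idx(1)[OF t]] G_pos[OF idx(2)[OF t]] by auto
      qed
      have "nrm d (x (s + 1) - x' (s + 1)) \<le> 2 * sqrt (?S s + (step s)\<^sup>2 * (G (idx s))\<^sup>2) + ?D s"
        using 1 IH D0 by (intro sqrt_plus_const_growth[where v = "nrm d (x s - x' s)"])
          (auto intro: sum_nonneg simp: mult.assoc)
      then show ?thesis using 2 by (simp add: fun_diff_def)
    qed
  qed
qed

end

section \<open>Averages over random orders\<close>

definition mean :: "'a set \<Rightarrow> ('a \<Rightarrow> real) \<Rightarrow> real" where
  "mean A Y = (\<Sum>x\<in>A. Y x) / real (card A)"

lemma mean_add: "mean A (\<lambda>x. Y x + Z x) = mean A Y + mean A Z"
  by (simp add: mean_def sum.distrib add_divide_distrib)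

lemma mean_diff: "mean A (\<lambda>x. Y x - Z x) = mean A Y - mean A Z"
  by (simp add: mean_def sum_subtractf diff_divide_distrib)

lemma mean_mult_left: "mean A (\<lambda>x. c * Y x) = c * mean A Y"
  by (simp add: mean_def sum_distrib_left)

lemma mean_divide: "mean A (\<lambda>x. Y x / c) = mean A Y / c"
  by (simp add: mean_def sum_divide_distrib mult.commute)

lemma mean_sum: "mean A (\<lambda>x. \<Sum>i\<in>I. Y i x) = (\<Sum>i\<in>I. mean A (Y i))"
  unfolding mean_def by (subst sum.swap) (simp add: sum_divide_distrib)

lemma mean_mono: "(\<And>x. x \<in> A \<Longrightarrow> Y x \<le> Z x) \<Longrightarrow> mean A Y \<le> mean A Z"
  unfolding mean_def by (intro divide_right_mono sum_mono) auto

lemma mean_cong: "(\<And>x. x \<in> A \<Longrightarrow> Y x = Z x) \<Longrightarrow> mean A Y = mean A Z"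
  unfolding mean_def by simp

lemma mean_const: "finite A \<Longrightarrow> A \<noteq> {} \<Longrightarrow> mean A (\<lambda>_. c) = c"
  by (simp add: mean_def)

lemma abs_mean_le: "\<bar>mean A Y\<bar> \<le> mean A (\<lambda>x. \<bar>Y x\<bar>)"
  unfolding mean_def by (simp add: divide_right_mono)

lemma mean_reindex:
  assumes "bij_betw h A A"
  shows "mean A (\<lambda>x. Y (h x)) = mean A Y"
  unfolding mean_def using sum.reindex_bij_betw[OF assms, of Y] by simp

definition RR_orders :: "nat \<Rightarrow> nat \<Rightarrow> (nat \<Rightarrow> nat \<Rightarrow> nat) set" where
  "RR_orders n Q = PiE_dflt {1..Q} id (\<lambda>_. {p. p permutes {1..n}})"

lemma finite_RR_orders: "finite (RR_orders n Q)"
  unfolding RR_orders_def by (intro finite_PiE_dflt) (auto intro: finite_permutations)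

lemma RR_orders_nonempty: "RR_orders n Q \<noteq> {}"
  unfolding RR_orders_def by (auto intro: permutes_id)

lemma RR_pmf_eq: "RR_pmf n Q = pmf_of_set (RR_orders n Q)"
  unfolding RR_pmf_def RR_orders_def
  by (rule Pi_pmf_of_set) (auto intro: permutes_id finite_permutations)

lemma set_RR_pmf: "set_pmf (RR_pmf n Q) = RR_orders n Q"
  by (simp add: RR_pmf_eq set_pmf_of_set finite_RR_orders RR_orders_nonempty)

lemma RR_orders_permutes: "\<omega> \<in> RR_orders n Q \<Longrightarrow> q \<in> {1..Q} \<Longrightarrow> \<omega> q permutes {1..n}"
  by (auto simp: RR_orders_def PiE_dflt_def)

definition exchange :: "nat \<Rightarrow> nat \<Rightarrow> nat \<Rightarrow> (nat \<Rightarrow> nat \<Rightarrow> nat) \<Rightarrow> (nat \<Rightarrow> nat \<Rightarrow> nat)" where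
  "exchange q j r \<omega> = fun_upd \<omega> q (\<omega> q \<circ> Transposition.transpose j r)"

lemma exchange_in_RR_orders:
  assumes "\<omega> \<in> RR_orders n Q" "q \<in> {1..Q}" "j \<in> {1..n}" "r \<in> {1..n}"
  shows "exchange q j r \<omega> \<in> RR_orders n Q"
  using assms permutes_compose[OF permutes_swap_id[of j "{1..n}" r], of "\<omega> q"]
    RR_orders_permutes[OF assms(1,2)]
  unfolding RR_orders_def PiE_dflt_def exchange_def by auto

lemma exchange_exchange: "exchange q j r (exchange q j r \<omega>) = \<omega>"
  by (auto simp: exchange_def fun_eq_iff)

text \<open>This exchangeability is the only probabilistic fact about random orders that the proof uses.\<close>

lemma mean_exchange:
  assumes "q \<in> {1..Q}" "j \<in> {1..n}" "r \<in> {1..n}"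
  shows "mean (RR_orders n Q) (\<lambda>\<omega>. Y (exchange q j r \<omega>)) = mean (RR_orders n Q) Y"
  by (intro mean_reindex bij_betwI[where g = "exchange q j r"])
    (use assms exchange_in_RR_orders exchange_exchange in auto)

lemma sum_RR_orders_entries:
  fixes \<phi> :: "nat \<Rightarrow> real"
  assumes "\<omega> \<in> RR_orders n Q" "q \<in> {1..Q}"
  shows "(\<Sum>j=1..n. \<phi> (\<omega> q j)) = (\<Sum>i=1..n. \<phi> i)"
  using sum.permute[OF RR_orders_permutes[OF assms], of \<phi>] by (simp add: o_def)

lemma mean_entry:
  fixes \<phi> :: "nat \<Rightarrow> real"
  assumes q: "q \<in> {1..Q}" and j: "j \<in> {1..n}"
  shows "mean (RR_orders n Q) (\<lambda>\<omega>. \<phi> (\<omega> q j)) = (\<Sum>i=1..n. \<phi> i) / real n"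
proof -
  let ?M = "\<lambda>j. mean (RR_orders n Q) (\<lambda>\<omega>. \<phi> (\<omega> q j))"
  have "?M r = ?M j" if r: "r \<in> {1..n}" for r
    using mean_exchange[OF q j r, of "\<lambda>\<omega>. \<phi> (\<omega> q j)"] by (simp add: exchange_def)
  then have "(\<Sum>r=1..n. ?M r) = real n * ?M j" by simp
  moreover have "(\<Sum>r=1..n. ?M r) = mean (RR_orders n Q) (\<lambda>\<omega>. \<Sum>i=1..n. \<phi> i)"
    unfolding mean_sum[symmetric] using sum_RR_orders_entries[OF _ q] by (intro mean_cong) auto
  ultimately show ?thesis
    using j by (simp add: mean_const finite_RR_orders RR_orders_nonempty field_simps)
qed

text \<open>Two entries of a random permutation are not independent, but nearly so: conditioning on one of
  them changes the law of the other by a factor of at most \<open>n / (n - 1) \<le> 2\<close>.\<close>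

lemma mean_entry_pair_le:
  fixes \<phi> \<xi> :: "nat \<Rightarrow> real"
  assumes q: "q \<in> {1..Q}" and r: "r \<in> {1..n}" and k: "k \<in> {1..n}" and ne: "r \<noteq> k"
    and pos: "\<And>i. i \<in> {1..n} \<Longrightarrow> 0 \<le> \<phi> i" "\<And>i. i \<in> {1..n} \<Longrightarrow> 0 \<le> \<xi> i"
  shows "mean (RR_orders n Q) (\<lambda>\<omega>. \<phi> (\<omega> q r) * \<xi> (\<omega> q k))
           \<le> 2 * ((\<Sum>i=1..n. \<phi> i) / real n) * ((\<Sum>i=1..n. \<xi> i) / real n)"
proof -
  let ?\<Omega> = "RR_orders n Q"
  let ?M = "\<lambda>j. mean ?\<Omega> (\<lambda>\<omega>. \<phi> (\<omega> q r) * \<xi> (\<omega> q j))"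
  have n2: "2 \<le> n" using r k ne by auto
  have "?M j = ?M k" if j: "j \<in> {1..n} - {r}" for j
    using mean_exchange[OF q k, of j "\<lambda>\<omega>. \<phi> (\<omega> q r) * \<xi> (\<omega> q k)"] ne j
    by (simp add: exchange_def)
  then have "(\<Sum>j\<in>{1..n} - {r}. ?M j) = real (n - 1) * ?M k"
    using r by (simp add: card_Diff_singleton)
  moreover have nonneg: "0 \<le> ?M j" if j: "j \<in> {1..n}" for j
  proof -
    have "mean ?\<Omega> (\<lambda>_. 0) \<le> ?M j"
    proof (intro mean_mono mult_nonneg_nonneg pos)
      fix \<omega> assume "\<omega> \<in> ?\<Omega>"
      from RR_orders_permutes[OF this q] r j show "\<omega> q r \<in> {1..n}" "\<omega> q j \<in> {1..n}"
        by (auto simp: permutes_in_image simp del: atLeastAtMost_iff)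
    qed
    then show ?thesis by (simp add: mean_def)
  qed
  moreover have "(\<Sum>j\<in>{1..n} - {r}. ?M j) \<le> (\<Sum>j=1..n. ?M j)"
    using nonneg by (intro sum_mono2) auto
  moreover have "(\<Sum>j=1..n. ?M j) = mean ?\<Omega> (\<lambda>\<omega>. (\<Sum>i=1..n. \<xi> i) * \<phi> (\<omega> q r))"
    unfolding mean_sum[symmetric] sum_distrib_left[symmetric] using sum_RR_orders_entries[OF _ q]
    by (intro mean_cong) (simp add: mult.commute)
  ultimately have "real (n - 1) * ?M k \<le> (\<Sum>i=1..n. \<xi> i) * ((\<Sum>i=1..n. \<phi> i) / real n)"
    by (simp only: mean_mult_left mean_entry[OF q r])
  moreover have "real n * ?M k \<le> 2 * (real (n - 1) * ?M k)"
    using n2 nonneg[OF k] mult_right_mono[of "real n" "2 * real (n - 1)" "?M k"]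
    by (simp add: of_nat_diff algebra_simps)
  ultimately have "real n * ?M k \<le> 2 * ((\<Sum>i=1..n. \<xi> i) * ((\<Sum>i=1..n. \<phi> i) / real n))"
    by linarith
  then show ?thesis using n2 by (simp add: field_simps)
qed

section \<open>Epochs\<close>

lemma epoch_eq:
  assumes "1 \<le> n" "1 \<le> t"
  shows "epoch n t = (t - 1) div n + 1"
proof -
  have n: "0 < n" using assms by simp
  have "\<lceil>real t / real n\<rceil> = int ((t - 1) div n) + 1"
  proof (rule ceiling_unique)
    have 1: "n * ((t - 1) div n) \<le> t - 1" by simp
    have 2: "t - 1 < n * ((t - 1) div n) + n"
      using n by (metis add.commute mult.commute dividend_less_div_times)
    have "n * ((t - 1) div n) < t" using 1 assms by linarith
    then have "real n * real ((t - 1) div n) < real t"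
      unfolding of_nat_mult[symmetric] of_nat_less_iff .
    then show "real_of_int (int ((t - 1) div n) + 1) - 1 < real t / real n"
      using n by (simp add: field_simps)
    have "t \<le> n * ((t - 1) div n) + n" using 2 assms by linarith
    then have "real t \<le> real n * real ((t - 1) div n) + real n"
      unfolding of_nat_mult[symmetric] of_nat_add[symmetric] of_nat_le_iff .
    then show "real t / real n \<le> real_of_int (int ((t - 1) div n) + 1)"
      using n by (simp add: field_simps)
  qed
  then show ?thesis by (simp add: epoch_def nat_add_distrib)
qed

lemma pos_in_epoch_eq:
  assumes "1 \<le> n" "1 \<le> t"
  shows "pos_in_epoch n t = (t - 1) mod n + 1"
proof -
  have "(t - 1) mod n + (t - 1) div n * n = t - 1" by simp
  then show ?thesis
    unfolding pos_in_epoch_def epoch_eq[OF assms] add_diff_cancel_right' using assms(2) by arith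
qed

lemma time_decomposition:
  assumes "1 \<le> n" "1 \<le> t"
  shows "(epoch n t - 1) * n + pos_in_epoch n t = t"
    and "pos_in_epoch n t \<in> {1..n}" and "1 \<le> epoch n t"
proof -
  have "(t - 1) mod n + (t - 1) div n * n = t - 1" by simp
  then show "(epoch n t - 1) * n + pos_in_epoch n t = t"
    unfolding pos_in_epoch_eq[OF assms] epoch_eq[OF assms] using assms(2) by simp
  have "(t - 1) mod n < n" using assms by simp
  then show "pos_in_epoch n t \<in> {1..n}"
    unfolding pos_in_epoch_eq[OF assms] by auto
  show "1 \<le> epoch n t" by (simp add: epoch_eq[OF assms])
qed

lemma epoch_at:
  assumes "1 \<le> q" "k \<in> {1..n}"
  shows "epoch n ((q - 1) * n + k) = q" and "pos_in_epoch n ((q - 1) * n + k) = k"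
proof -
  have n: "1 \<le> n" "1 \<le> (q - 1) * n + k" and e: "(q - 1) * n + k - 1 = (q - 1) * n + (k - 1)" "k - 1 < n"
    using assms by auto
  have dm: "((q - 1) * n + (k - 1)) div n = q - 1" "((q - 1) * n + (k - 1)) mod n = k - 1"
    using e(2) by simp_all
  show "epoch n ((q - 1) * n + k) = q" "pos_in_epoch n ((q - 1) * n + k) = k"
    unfolding epoch_eq[OF n] pos_in_epoch_eq[OF n] e(1) dm using assms by auto
qed

lemma epoch_mono: "1 \<le> n \<Longrightarrow> 1 \<le> s \<Longrightarrow> s \<le> t \<Longrightarrow> epoch n s \<le> epoch n t"
  by (simp add: epoch_eq div_le_mono diff_le_mono)

section \<open>The bias of sampling without replacement\<close>

lemma sum_later_entries_le:
  fixes c :: "nat \<Rightarrow> real"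
  assumes "\<And>k. 0 \<le> c k"
  shows "(\<Sum>j\<in>{1..<r}. \<Sum>k\<in>{j<..<r}. c k) \<le> (\<Sum>k\<in>{1..<r}. real k * c k)"
proof (induction r)
  case 0
  then show ?case by simp
next
  case (Suc r)
  show ?case
  proof (cases "1 \<le> r")
    case True
    have "(\<Sum>j\<in>{1..<Suc r}. \<Sum>k\<in>{j<..<Suc r}. c k) = (\<Sum>j\<in>{1..<r}. \<Sum>k\<in>{j<..<Suc r}. c k)"
    proof -
      have "{r<..<Suc r} = {}" by auto
      with True show ?thesis by simp
    qed
    also have "\<dots> = (\<Sum>j\<in>{1..<r}. c r + (\<Sum>k\<in>{j<..<r}. c k))"
    proof (intro sum.cong refl)
      fix j assume "j \<in> {1..<r}"
      then have "{j<..<Suc r} = insert r {j<..<r}" by auto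
      then show "(\<Sum>k\<in>{j<..<Suc r}. c k) = c r + (\<Sum>k\<in>{j<..<r}. c k)" by simp
    qed
    also have "\<dots> = real (r - 1) * c r + (\<Sum>j\<in>{1..<r}. \<Sum>k\<in>{j<..<r}. c k)"
      by (simp add: sum.distrib)
    also have "\<dots> \<le> real r * c r + (\<Sum>k\<in>{1..<r}. real k * c k)"
      using Suc assms[of r] by (intro add_mono mult_right_mono) auto
    also have "\<dots> = (\<Sum>k\<in>{1..<Suc r}. real k * c k)"
      using True by simp
    finally show ?thesis .
  qed simp
qed

lemma sum_inverse_sqrt_le: "(\<Sum>j=1..m. 1 / sqrt (real j)) \<le> 2 * sqrt (real m)"
proof (induction m)
  case (Suc m)
  have "sqrt (real m) * sqrt (real (Suc m)) \<le> (real m + real (Suc m)) / 2"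
    by (rule arith_geo_mean_sqrt[unfolded real_sqrt_mult]) auto
  then have "1 / sqrt (real (Suc m)) \<le> 2 * (sqrt (real (Suc m)) - sqrt (real m))"
    by (simp add: field_simps)
  then show ?case using Suc by simp
qed simp

text \<open>In \<open>step_regular\<close> the step at position \<open>k\<close> of the epoch of \<open>t\<close> may exceed \<open>step t\<close> by a
  factor of at most \<open>sqrt (n / k)\<close>. This covers steps that are constant within each epoch and, including the first epoch,
  steps proportional to \<open>1 / sqrt t\<close>.\<close>

locale rr_run = composite_problem d n f g G \<psi>
  for d n :: nat
    and f :: "nat \<Rightarrow> (nat \<Rightarrow> real) \<Rightarrow> real"
    and g :: "nat \<Rightarrow> (nat \<Rightarrow> real) \<Rightarrow> (nat \<Rightarrow> real)"
    and G :: "nat \<Rightarrow> real"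
    and \<psi> :: "(nat \<Rightarrow> real) \<Rightarrow> ereal" +
  fixes T :: nat and step :: "nat \<Rightarrow> real" and x1 :: "nat \<Rightarrow> real"
    and X :: "(nat \<Rightarrow> nat \<Rightarrow> nat) \<Rightarrow> nat \<Rightarrow> nat \<Rightarrow> real"
  assumes T_pos: "1 \<le> T"
    and x1_edom: "x1 \<in> edom d \<psi>"
    and step_pos: "\<And>t. t \<in> {1..T} \<Longrightarrow> 0 < step t"
    and step_regular: "\<And>t k. t \<in> {1..T} \<Longrightarrow> k \<in> {1..pos_in_epoch n t} \<Longrightarrow>
       real k * (step ((epoch n t - 1) * n + k))\<^sup>2 \<le> real n * (step t)\<^sup>2"
    and run: "RR_iterates d n T g \<psi> step x1 X"
begin

abbreviation \<Omega> :: "(nat \<Rightarrow> nat \<Rightarrow> nat) set" where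
  "\<Omega> \<equiv> RR_orders n (epoch n T)"

definition f_avg :: "(nat \<Rightarrow> real) \<Rightarrow> real" where
  "f_avg x = (\<Sum>i=1..n. f i x) / real n"

definition K :: real where
  "K = sqrt (real n) * Gf1 n G * Gf2 n G"

lemma trajectory: "\<omega> \<in> \<Omega> \<Longrightarrow> prox_grad_iterates d T g \<psi> step (RR_index n \<omega>) x1 (X \<omega>)"
  using run by (simp add: RR_iterates_def set_RR_pmf)

lemma epoch_range: "t \<in> {1..T} \<Longrightarrow> epoch n t \<in> {1..epoch n T}"
  using time_decomposition(3)[of n t] epoch_mono[of n t T] n_pos by auto

lemma index_range:
  assumes "\<omega> \<in> \<Omega>" "t \<in> {1..T}"
  shows "RR_index n \<omega> t \<in> {1..n}"
  using permutes_in_image[OF RR_orders_permutes[OF assms(1) epoch_range[OF assms(2)]]]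
    time_decomposition(2)[of n t] n_pos assms(2) unfolding RR_index_def by auto

lemma X_edom: "\<omega> \<in> \<Omega> \<Longrightarrow> s \<in> {1..T + 1} \<Longrightarrow> X \<omega> s \<in> edom d \<psi>"
  using iterates_edom[OF trajectory step_pos x1_edom] by blast

lemma Gf1_pos: "0 < Gf1 n G"
  unfolding Gf1_def using n_pos G_pos by (intro divide_pos_pos sum_pos) auto

lemma Gf2_pos: "0 < Gf2 n G"
proof -
  have "0 < (G i)\<^sup>2" if "i \<in> {1..n}" for i using G_pos[OF that] by simp
  then show ?thesis
    unfolding Gf2_def using n_pos by (intro real_sqrt_gt_zero divide_pos_pos sum_pos) auto
qed

lemma Gf2_sq: "(Gf2 n G)\<^sup>2 = (\<Sum>i=1..n. (G i)\<^sup>2) / real n"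
  unfolding Gf2_def by (simp add: sum_nonneg)

lemma Gf2_sq_le_K: "(Gf2 n G)\<^sup>2 \<le> K"
proof -
  have "(\<Sum>i=1..n. (G i)\<^sup>2) \<le> (\<Sum>i=1..n. G i * (\<Sum>k=1..n. G k))"
    unfolding power2_eq_square
  proof (intro sum_mono mult_left_mono member_le_sum)
    show "0 \<le> G i" if "i \<in> {1..n}" for i using G_pos[OF that] by simp
    then show "0 \<le> G k" if "k \<in> {1..n} - {i}" for k i using that by blast
  qed auto
  also have "\<dots> = (\<Sum>i=1..n. G i)\<^sup>2"
    by (simp add: sum_distrib_right[symmetric] power2_eq_square)
  finally have "(Gf2 n G)\<^sup>2 \<le> real n * (Gf1 n G)\<^sup>2"
    using n_pos unfolding Gf2_sq Gf1_def
    by (simp add: power_divide divide_right_mono power2_eq_square[of "real n"])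
  then have "(Gf2 n G)\<^sup>2 \<le> (sqrt (real n) * Gf1 n G)\<^sup>2"
    by (simp add: power_mult_distrib)
  then have "Gf2 n G \<le> sqrt (real n) * Gf1 n G"
    by (rule power2_le_imp_le) (use Gf1_pos in simp)
  then show ?thesis
    using Gf2_pos unfolding K_def power2_eq_square by (intro mult_right_mono) auto
qed

lemma K_pos: "0 < K"
  unfolding K_def using n_pos Gf1_pos Gf2_pos by (intro mult_pos_pos) auto

text \<open>As \<open>s \<le> t + 1\<close>, only steps up to position \<open>r\<close> have been taken. If \<open>j < r\<close>, the steps strictly between
  \<open>j\<close> and \<open>r\<close> use equal components and contribute the square root; if \<open>r < j\<close>, the two
  trajectories differ at most by the step at \<open>t\<close> itself.\<close>

lemma exchange_distance:
  assumes w: "\<omega> \<in> \<Omega>" and t: "t \<in> {1..T}" and s: "s \<in> {1..t + 1}"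
    and q: "q = epoch n t" and r: "r = pos_in_epoch n t" and j: "j \<in> {1..n}"
  shows "nrm d (X (exchange q j r \<omega>) s - X \<omega> s) \<le>
    (if j < r then 2 * sqrt (\<Sum>k\<in>{j<..<r}. (step ((q - 1) * n + k))\<^sup>2 * (G (\<omega> q k))\<^sup>2)
       + step ((q - 1) * n + j) * (G (\<omega> q j) + G (\<omega> q r)) else 0)
    + step t * (G (\<omega> q j) + G (\<omega> q r))"
proof -
  let ?w = "exchange q j r \<omega>"
  let ?b = "(q - 1) * n"
  let ?i = "RR_index n \<omega>" and ?i' = "RR_index n ?w"
  have q1: "q \<in> {1..epoch n T}" using epoch_range[OF t] q by simp
  have rn: "r \<in> {1..n}" and tb: "?b + r = t"
    using time_decomposition[of n t] n_pos t q r by auto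
  have w': "?w \<in> \<Omega>" by (rule exchange_in_RR_orders[OF w q1 j rn])
  have at: "RR_index n \<omega>' (?b + k) = \<omega>' q k" if "k \<in> {1..n}" for k \<omega>'
    using epoch_at[OF _ that, of q] q1 by (simp add: RR_index_def)
  have same: "?i u = ?i' u" if u: "1 \<le> u" "u \<notin> {?b + j, ?b + r}" for u
  proof (cases "epoch n u = q")
    case True
    then have "?b + pos_in_epoch n u = u" using time_decomposition(1)[of n u] n_pos u by simp
    then have "pos_in_epoch n u \<noteq> j" "pos_in_epoch n u \<noteq> r" using u by auto
    then show ?thesis by (simp add: RR_index_def exchange_def True)
  next
    case False
    then show ?thesis by (simp add: RR_index_def exchange_def)
  qed
  have s': "1 \<le> s" "s \<le> T + 1" "s \<le> ?b + r + 1" using s t tb by auto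
  let ?a = "?b + min j r"
  let ?D = "{?b + j, ?b + r}"
  have stable: "nrm d (X \<omega> s - X ?w s) \<le> 2 * sqrt (\<Sum>u\<in>{?a..<s} - ?D. (step u)\<^sup>2 * (G (?i u))\<^sup>2)
      + (\<Sum>u\<in>{?a..<s} \<inter> ?D. step u * (G (?i u) + G (?i' u)))"
  proof (rule iterates_stable[OF trajectory[OF w] trajectory[OF w'] step_pos x1_edom
        index_range[OF w] index_range[OF w'] _ _ _ s'(1,2)])
    show "?i u = ?i' u" if "1 \<le> u" "u < ?a" for u using that by (intro same) auto
    show "?i u = ?i' u" if "u \<in> {1..T}" "u \<notin> ?D" for u using that by (intro same) auto
    have "1 \<le> min j r" using j rn by simp
    then show "1 \<le> ?a" by linarith
  qed
  have Gw: "0 \<le> G (\<omega> q k)" if "k \<in> {1..n}" for k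
    using G_pos[of "\<omega> q k"] permutes_in_image[OF RR_orders_permutes[OF w q1], of k] that by simp
  have swapped: "?w q j = \<omega> q r" "?w q r = \<omega> q j" by (simp_all add: exchange_def)
  have D_term: "step u * (G (?i u) + G (?i' u)) = step u * (G (\<omega> q j) + G (\<omega> q r))" if "u \<in> ?D" for u
    using that at[OF j] at[OF rn] swapped by (auto simp: add.commute)
  have st: "0 \<le> step t" using step_pos[OF t] by simp
  show ?thesis
  proof (cases "j < r")
    case True
    have tj: "?b + j \<in> {1..T}" using True j tb t by auto
    then have sj: "0 \<le> step (?b + j)" using step_pos[OF tj] by simp
    have "(\<Sum>u\<in>{?a..<s} - ?D. (step u)\<^sup>2 * (G (?i u))\<^sup>2)
        \<le> (\<Sum>u\<in>(+) ?b ` {j<..<r}. (step u)\<^sup>2 * (G (?i u))\<^sup>2)"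
    proof (rule sum_mono2)
      show "{?a..<s} - ?D \<subseteq> (+) ?b ` {j<..<r}"
      proof
        fix u assume "u \<in> {?a..<s} - ?D"
        then have "u = ?b + (u - ?b)" "u - ?b \<in> {j<..<r}" using s' True by auto
        then show "u \<in> (+) ?b ` {j<..<r}" by (rule image_eqI)
      qed
    qed auto
    also have "\<dots> = (\<Sum>k\<in>{j<..<r}. (step (?b + k))\<^sup>2 * (G (?i (?b + k)))\<^sup>2)"
      by (subst sum.reindex) auto
    also have "\<dots> = (\<Sum>k\<in>{j<..<r}. (step (?b + k))\<^sup>2 * (G (\<omega> q k))\<^sup>2)"
    proof (intro sum.cong refl)
      fix k assume "k \<in> {j<..<r}"
      then have "k \<in> {1..n}" using rn j by auto
      from at[OF this, of \<omega>]
      show "(step (?b + k))\<^sup>2 * (G (?i (?b + k)))\<^sup>2 = (step (?b + k))\<^sup>2 * (G (\<omega> q k))\<^sup>2" by simp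
    qed
    finally have 1: "sqrt (\<Sum>u\<in>{?a..<s} - ?D. (step u)\<^sup>2 * (G (?i u))\<^sup>2)
        \<le> sqrt (\<Sum>k\<in>{j<..<r}. (step (?b + k))\<^sup>2 * (G (\<omega> q k))\<^sup>2)"
      by simp
    have "(\<Sum>u\<in>{?a..<s} \<inter> ?D. step u * (G (?i u) + G (?i' u)))
        = (\<Sum>u\<in>{?a..<s} \<inter> ?D. step u * (G (\<omega> q j) + G (\<omega> q r)))"
      using D_term by (intro sum.cong refl) auto
    also have "\<dots> \<le> (\<Sum>u\<in>?D. step u * (G (\<omega> q j) + G (\<omega> q r)))"
      using sj st Gw[OF j] Gw[OF rn] tb by (intro sum_mono2) auto
    also have "\<dots> = step (?b + j) * (G (\<omega> q j) + G (\<omega> q r)) + step t * (G (\<omega> q j) + G (\<omega> q r))"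
      using True tb by simp
    finally show ?thesis
      using stable 1 unfolding nrm_minus_commute[of d "X ?w s"] if_P[OF True] by linarith
  next
    case False
    then have e: "{?a..<s} - ?D = {}" "{?a..<s} \<inter> ?D \<subseteq> {?b + r}" using s' by auto
    have "(\<Sum>u\<in>{?a..<s} \<inter> ?D. step u * (G (?i u) + G (?i' u)))
        = (\<Sum>u\<in>{?a..<s} \<inter> ?D. step u * (G (\<omega> q j) + G (\<omega> q r)))"
      using D_term by (intro sum.cong refl) auto
    also have "\<dots> \<le> (\<Sum>u\<in>{?b + r}. step u * (G (\<omega> q j) + G (\<omega> q r)))"
      using st Gw[OF j] Gw[OF rn] tb e by (intro sum_mono2) auto
    finally show ?thesis
      using stable False tb unfolding nrm_minus_commute[of d "X ?w s"] e(1) by simp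
  qed
qed

end

context rr_run
begin

text \<open>Exchanging \<open>r\<close>, the position of \<open>t\<close>, with every position \<open>j\<close> compares the average of all
  components with the component used at time \<open>t\<close>: in mean, \<open>f (\<omega> q j)\<close> at \<open>X \<omega> s\<close> equals
  \<open>f (\<omega> q r)\<close> at the trajectory of the exchanged order.\<close>

lemma bias_le_exchange_distance:
  assumes t: "t \<in> {1..T}" and s: "s \<in> {1..t + 1}"
    and q: "q = epoch n t" and r: "r = pos_in_epoch n t"
  shows "\<bar>mean \<Omega> (\<lambda>\<omega>. f_avg (X \<omega> s)) - mean \<Omega> (\<lambda>\<omega>. f (\<omega> q r) (X \<omega> s))\<bar>
    \<le> (\<Sum>j=1..n. mean \<Omega> (\<lambda>\<omega>. G (\<omega> q r) * nrm d (X (exchange q j r \<omega>) s - X \<omega> s))) / real n"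
proof -
  have q1: "q \<in> {1..epoch n T}" using epoch_range[OF t] q by simp
  have rn: "r \<in> {1..n}" using time_decomposition[of n t] n_pos t r by auto
  have n0: "0 < real n" using n_pos by simp
  have sT: "s \<in> {1..T + 1}" using s t by auto
  let ?D = "\<lambda>j \<omega>. f (\<omega> q r) (X (exchange q j r \<omega>) s) - f (\<omega> q r) (X \<omega> s)"
  have "mean \<Omega> (\<lambda>\<omega>. f_avg (X \<omega> s)) = mean \<Omega> (\<lambda>\<omega>. (\<Sum>j=1..n. f (\<omega> q j) (X \<omega> s)) / real n)"
  proof (rule mean_cong)
    fix \<omega> assume w: "\<omega> \<in> \<Omega>"
    show "f_avg (X \<omega> s) = (\<Sum>j=1..n. f (\<omega> q j) (X \<omega> s)) / real n"
      using sum_RR_orders_entries[OF w q1, of "\<lambda>i. f i (X \<omega> s)"] by (simp add: f_avg_def)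
  qed
  also have "\<dots> = (\<Sum>j=1..n. mean \<Omega> (\<lambda>\<omega>. f (\<omega> q j) (X \<omega> s))) / real n"
    unfolding mean_divide mean_sum ..
  also have "\<dots> = (\<Sum>j=1..n. mean \<Omega> (\<lambda>\<omega>. f (\<omega> q r) (X (exchange q j r \<omega>) s))) / real n"
  proof -
    have "mean \<Omega> (\<lambda>\<omega>. f (\<omega> q r) (X (exchange q j r \<omega>) s)) = mean \<Omega> (\<lambda>\<omega>. f (\<omega> q j) (X \<omega> s))"
      if j: "j \<in> {1..n}" for j
      using mean_exchange[OF q1 j rn, of "\<lambda>\<omega>. f (\<omega> q j) (X \<omega> s)"] by (simp add: exchange_def)
    then show ?thesis by simp
  qed
  finally have diff: "mean \<Omega> (\<lambda>\<omega>. f_avg (X \<omega> s)) - mean \<Omega> (\<lambda>\<omega>. f (\<omega> q r) (X \<omega> s))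
      = (\<Sum>j=1..n. mean \<Omega> (?D j)) / real n"
    using n0 by (simp add: mean_diff sum_subtractf field_simps)
  have "\<bar>(\<Sum>j=1..n. mean \<Omega> (?D j)) / real n\<bar> \<le> (\<Sum>j=1..n. \<bar>mean \<Omega> (?D j)\<bar>) / real n"
    unfolding abs_divide abs_of_nat by (intro divide_right_mono sum_abs) simp
  also have "\<dots> \<le> (\<Sum>j=1..n. mean \<Omega> (\<lambda>\<omega>. G (\<omega> q r) * nrm d (X (exchange q j r \<omega>) s - X \<omega> s))) / real n"
  proof (rule divide_right_mono[OF sum_mono])
    fix j assume j: "j \<in> {1..n}"
    have "\<bar>mean \<Omega> (?D j)\<bar> \<le> mean \<Omega> (\<lambda>\<omega>. \<bar>?D j \<omega>\<bar>)" by (rule abs_mean_le)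
    also have "\<dots> \<le> mean \<Omega> (\<lambda>\<omega>. G (\<omega> q r) * nrm d (X (exchange q j r \<omega>) s - X \<omega> s))"
    proof (rule mean_mono)
      fix \<omega> assume w: "\<omega> \<in> \<Omega>"
      have "\<omega> q r \<in> {1..n}"
        using permutes_in_image[OF RR_orders_permutes[OF w q1], of r] rn by simp
      then show "\<bar>?D j \<omega>\<bar> \<le> G (\<omega> q r) * nrm d (X (exchange q j r \<omega>) s - X \<omega> s)"
        using X_edom[OF exchange_in_RR_orders[OF w q1 j rn] sT] X_edom[OF w sT]
        by (rule f_lipschitz)
    qed
    finally show "\<bar>mean \<Omega> (?D j)\<bar>
        \<le> mean \<Omega> (\<lambda>\<omega>. G (\<omega> q r) * nrm d (X (exchange q j r \<omega>) s - X \<omega> s))" .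
  qed simp
  finally show ?thesis unfolding diff .
qed

text \<open>The square root in the distance is split as \<open>2 * sqrt Y \<le> Y / l + l\<close> with a constant
  \<open>l\<close>, so that only second moments under \<open>G (\<omega> q r)\<close> remain and the product of the two
  different averages of \<open>G\<close> survives; the Cauchy-Schwarz inequality would give \<open>(Gf2 n G)\<^sup>2\<close> instead.\<close>

lemma mean_exchange_distance:
  assumes t: "t \<in> {1..T}" and s: "s \<in> {1..t + 1}"
    and q: "q = epoch n t" and r: "r = pos_in_epoch n t" and j: "j \<in> {1..n}" and l: "0 < l"
  shows "mean \<Omega> (\<lambda>\<omega>. G (\<omega> q r) * nrm d (X (exchange q j r \<omega>) s - X \<omega> s))
    \<le> (if j < r then
          (\<Sum>k\<in>{j<..<r}. (step ((q - 1) * n + k))\<^sup>2) * (2 * Gf1 n G * (Gf2 n G)\<^sup>2 / l)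
          + l * Gf1 n G + step ((q - 1) * n + j) * (2 * (Gf2 n G)\<^sup>2) else 0)
        + step t * (2 * (Gf2 n G)\<^sup>2)"
proof -
  have q1: "q \<in> {1..epoch n T}" using epoch_range[OF t] q by simp
  have rn: "r \<in> {1..n}" and tb: "(q - 1) * n + r = t"
    using time_decomposition[of n t] n_pos t q r by auto
  let ?b = "(q - 1) * n"
  have Gw: "0 \<le> G (\<omega> q k)" if "\<omega> \<in> \<Omega>" "k \<in> {1..n}" for k \<omega>
    using G_pos[of "\<omega> q k"] permutes_in_image[OF RR_orders_permutes[OF that(1) q1], of k] that(2)
    by simp
  have Gi: "0 \<le> G i" if "i \<in> {1..n}" for i using G_pos[OF that] by simp
  have st: "0 \<le> step t" using step_pos[OF t] by simp
  let ?P = "\<lambda>\<omega>. 3 / 2 * (G (\<omega> q r))\<^sup>2 + 1 / 2 * (G (\<omega> q j))\<^sup>2"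
  have P: "G (\<omega> q r) * (G (\<omega> q j) + G (\<omega> q r)) \<le> ?P \<omega>" for \<omega>
    using zero_le_power2[of "G (\<omega> q r) - G (\<omega> q j)"] by (simp add: power2_eq_square algebra_simps)
  have mP: "mean \<Omega> ?P = 2 * (Gf2 n G)\<^sup>2"
    using mean_entry[OF q1 rn, of "\<lambda>i. (G i)\<^sup>2"] mean_entry[OF q1 j, of "\<lambda>i. (G i)\<^sup>2"]
    by (simp only: mean_add mean_mult_left Gf2_sq) simp
  show ?thesis
  proof (cases "j < r")
    case False
    have "mean \<Omega> (\<lambda>\<omega>. G (\<omega> q r) * nrm d (X (exchange q j r \<omega>) s - X \<omega> s)) \<le> mean \<Omega> (\<lambda>\<omega>. step t * ?P \<omega>)"
    proof (rule mean_mono)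
      fix \<omega> assume w: "\<omega> \<in> \<Omega>"
      have "G (\<omega> q r) * nrm d (X (exchange q j r \<omega>) s - X \<omega> s)
          \<le> G (\<omega> q r) * (step t * (G (\<omega> q j) + G (\<omega> q r)))"
        using exchange_distance[OF w t s q r j] False Gw[OF w rn] by (intro mult_left_mono) simp_all
      also have "\<dots> = step t * (G (\<omega> q r) * (G (\<omega> q j) + G (\<omega> q r)))" by simp
      also have "\<dots> \<le> step t * ?P \<omega>" by (intro mult_left_mono P st)
      finally show "G (\<omega> q r) * nrm d (X (exchange q j r \<omega>) s - X \<omega> s) \<le> step t * ?P \<omega>" .
    qed
    then show ?thesis using False unfolding mean_mult_left mP by simp
  next
    case True
    let ?S = "\<lambda>\<omega>. \<Sum>k\<in>{j<..<r}. (step (?b + k))\<^sup>2 * (G (\<omega> q r) * (G (\<omega> q k))\<^sup>2)"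
    have "?b + j \<in> {1..T}" using True j tb t by auto
    then have sj: "0 \<le> step (?b + j)" using step_pos by (simp add: less_imp_le)
    have "mean \<Omega> (\<lambda>\<omega>. G (\<omega> q r) * nrm d (X (exchange q j r \<omega>) s - X \<omega> s))
        \<le> mean \<Omega> (\<lambda>\<omega>. (1 / l * ?S \<omega> + l * G (\<omega> q r) + step (?b + j) * ?P \<omega>) + step t * ?P \<omega>)"
    proof (rule mean_mono)
      fix \<omega> assume w: "\<omega> \<in> \<Omega>"
      let ?Y = "\<Sum>k\<in>{j<..<r}. (step (?b + k))\<^sup>2 * (G (\<omega> q k))\<^sup>2"
      have Y0: "0 \<le> ?Y" by (intro sum_nonneg) simp
      have "0 \<le> (sqrt ?Y - l)\<^sup>2" by simp
      then have "2 * sqrt ?Y * l \<le> ?Y + l * l"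
        using Y0 by (simp add: power2_diff power2_eq_square[of l])
      then have Y: "2 * sqrt ?Y \<le> 1 / l * ?Y + l"
        using l by (simp add: field_simps)
      let ?g = "G (\<omega> q j) + G (\<omega> q r)"
      have "G (\<omega> q r) * nrm d (X (exchange q j r \<omega>) s - X \<omega> s)
          \<le> G (\<omega> q r) * ((1 / l * ?Y + l) + step (?b + j) * ?g + step t * ?g)"
        using exchange_distance[OF w t s q r j] Y unfolding if_P[OF True]
        by (intro mult_left_mono Gw[OF w rn]) linarith
      also have "\<dots> = (1 / l * (G (\<omega> q r) * ?Y) + l * G (\<omega> q r)
          + step (?b + j) * (G (\<omega> q r) * ?g)) + step t * (G (\<omega> q r) * ?g)"
        by (simp add: algebra_simps)
      also have "\<dots> \<le> (1 / l * (G (\<omega> q r) * ?Y) + l * G (\<omega> q r)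
          + step (?b + j) * ?P \<omega>) + step t * ?P \<omega>"
        by (intro add_mono order_refl mult_left_mono P st sj)
      also have "G (\<omega> q r) * ?Y = ?S \<omega>"
        unfolding sum_distrib_left by (intro sum.cong refl) simp
      finally show "G (\<omega> q r) * nrm d (X (exchange q j r \<omega>) s - X \<omega> s)
          \<le> (1 / l * ?S \<omega> + l * G (\<omega> q r) + step (?b + j) * ?P \<omega>) + step t * ?P \<omega>" .
    qed
    also have "\<dots> = (1 / l * mean \<Omega> ?S + l * mean \<Omega> (\<lambda>\<omega>. G (\<omega> q r))
        + step (?b + j) * mean \<Omega> ?P) + step t * mean \<Omega> ?P"
      unfolding mean_add mean_mult_left ..
    also have "mean \<Omega> (\<lambda>\<omega>. G (\<omega> q r)) = Gf1 n G"
      unfolding Gf1_def by (rule mean_entry[OF q1 rn])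
    also have "mean \<Omega> ?S = (\<Sum>k\<in>{j<..<r}. (step (?b + k))\<^sup>2 * mean \<Omega> (\<lambda>\<omega>. G (\<omega> q r) * (G (\<omega> q k))\<^sup>2))"
      unfolding mean_sum mean_mult_left ..
    finally have 1: "mean \<Omega> (\<lambda>\<omega>. G (\<omega> q r) * nrm d (X (exchange q j r \<omega>) s - X \<omega> s))
        \<le> (1 / l * (\<Sum>k\<in>{j<..<r}. (step (?b + k))\<^sup>2 * mean \<Omega> (\<lambda>\<omega>. G (\<omega> q r) * (G (\<omega> q k))\<^sup>2))
           + l * Gf1 n G + step (?b + j) * mean \<Omega> ?P) + step t * mean \<Omega> ?P" .
    have "(\<Sum>k\<in>{j<..<r}. (step (?b + k))\<^sup>2 * mean \<Omega> (\<lambda>\<omega>. G (\<omega> q r) * (G (\<omega> q k))\<^sup>2))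
        \<le> (\<Sum>k\<in>{j<..<r}. (step (?b + k))\<^sup>2 * (2 * Gf1 n G * (Gf2 n G)\<^sup>2))"
    proof (intro sum_mono mult_left_mono)
      fix k assume "k \<in> {j<..<r}"
      then have k: "k \<in> {1..n}" "r \<noteq> k" using rn j by auto
      show "mean \<Omega> (\<lambda>\<omega>. G (\<omega> q r) * (G (\<omega> q k))\<^sup>2) \<le> 2 * Gf1 n G * (Gf2 n G)\<^sup>2"
        unfolding Gf1_def Gf2_sq
        by (rule mean_entry_pair_le[OF q1 rn k, of G "\<lambda>i. (G i)\<^sup>2"]) (use Gi in auto)
    qed simp
    then have 2: "1 / l * (\<Sum>k\<in>{j<..<r}. (step (?b + k))\<^sup>2 * mean \<Omega> (\<lambda>\<omega>. G (\<omega> q r) * (G (\<omega> q k))\<^sup>2))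
        \<le> 1 / l * (\<Sum>k\<in>{j<..<r}. (step (?b + k))\<^sup>2 * (2 * Gf1 n G * (Gf2 n G)\<^sup>2))"
      using l by (intro mult_left_mono) auto
    have 3: "1 / l * (\<Sum>k\<in>{j<..<r}. (step (?b + k))\<^sup>2 * (2 * Gf1 n G * (Gf2 n G)\<^sup>2))
        = (\<Sum>k\<in>{j<..<r}. (step (?b + k))\<^sup>2) * (2 * Gf1 n G * (Gf2 n G)\<^sup>2 / l)"
      unfolding sum_distrib_right[symmetric] by simp
    show ?thesis
      unfolding if_P[OF True] using 1 2 unfolding 3 mP by linarith
  qed
qed

text \<open>Summed over \<open>j\<close>, the squared step at position \<open>k < r\<close> is counted \<open>k - 1\<close> times;
  \<open>step_regular\<close> bounds it with the weight \<open>k\<close>.\<close>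

lemma sampling_bias:
  assumes t: "t \<in> {1..T}" and s: "s \<in> {1..t + 1}"
  shows "\<bar>mean \<Omega> (\<lambda>\<omega>. f_avg (X \<omega> s)) - mean \<Omega> (\<lambda>\<omega>. f (RR_index n \<omega> t) (X \<omega> s))\<bar> \<le> 9 * K * step t"
proof -
  define q where "q = epoch n t"
  define r where "r = pos_in_epoch n t"
  define b where "b = (q - 1) * n"
  define h where "h = step t"
  define G1 where "G1 = Gf1 n G"
  define G2 where "G2 = Gf2 n G"
  \<comment> \<open>the order of the distance between two exchanged trajectories\<close>
  define l where "l = sqrt (real n) * G2 * h"
  have rn: "r \<in> {1..n}" and tb: "b + r = t"
    using time_decomposition[of n t] n_pos t unfolding q_def r_def b_def by auto
  have n0: "0 < real n" using n_pos by simp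
  have h: "0 < h" using step_pos[OF t] by (simp add: h_def)
  have G12: "0 < G1" "0 < G2" using Gf1_pos Gf2_pos by (simp_all add: G1_def G2_def)
  have l: "0 < l" using n0 h G12 by (simp add: l_def)
  have reg: "real k * (step (b + k))\<^sup>2 \<le> real n * h\<^sup>2" if "k \<in> {1..r}" for k
    using step_regular[OF t, of k] that unfolding q_def r_def b_def h_def by simp
  let ?c = "2 * G1 * G2\<^sup>2 / l"
  have "(\<Sum>j=1..n. mean \<Omega> (\<lambda>\<omega>. G (\<omega> q r) * nrm d (X (exchange q j r \<omega>) s - X \<omega> s)))
      \<le> (\<Sum>j=1..n. (if j < r then (\<Sum>k\<in>{j<..<r}. (step (b + k))\<^sup>2) * ?c + l * G1
            + step (b + j) * (2 * G2\<^sup>2) else 0) + h * (2 * G2\<^sup>2))"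
    unfolding b_def h_def G1_def G2_def
    by (intro sum_mono mean_exchange_distance[OF t s q_def r_def])
      (use l in \<open>auto simp: h_def G2_def\<close>)
  also have "\<dots> = (\<Sum>j\<in>{1..<r}. (\<Sum>k\<in>{j<..<r}. (step (b + k))\<^sup>2) * ?c + l * G1
            + step (b + j) * (2 * G2\<^sup>2)) + real n * (h * (2 * G2\<^sup>2))"
  proof -
    have "{j \<in> {1..n}. j < r} = {1..<r}" using rn by auto
    then show ?thesis by (simp add: sum.distrib sum.inter_filter[symmetric])
  qed
  also have "\<dots> = (\<Sum>j\<in>{1..<r}. \<Sum>k\<in>{j<..<r}. (step (b + k))\<^sup>2) * ?c + real (r - 1) * (l * G1)
            + (\<Sum>j\<in>{1..<r}. step (b + j)) * (2 * G2\<^sup>2) + real n * (h * (2 * G2\<^sup>2))"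
    unfolding sum.distrib sum_distrib_right[symmetric] by simp
  also have "\<dots> \<le> ((real n)\<^sup>2 * h\<^sup>2) * ?c + real n * (l * G1)
            + (2 * real n * h) * (2 * G2\<^sup>2) + real n * (h * (2 * G2\<^sup>2))"
  proof (intro add_mono mult_right_mono order_refl)
    have "(\<Sum>j\<in>{1..<r}. \<Sum>k\<in>{j<..<r}. (step (b + k))\<^sup>2) \<le> (\<Sum>k\<in>{1..<r}. real k * (step (b + k))\<^sup>2)"
      by (rule sum_later_entries_le) simp
    also have "\<dots> \<le> (\<Sum>k\<in>{1..<r}. real n * h\<^sup>2)"
      by (intro sum_mono reg) auto
    also have "\<dots> \<le> real n * (real n * h\<^sup>2)"
      using rn by (simp add: mult_right_mono)
    finally show "(\<Sum>j\<in>{1..<r}. \<Sum>k\<in>{j<..<r}. (step (b + k))\<^sup>2) \<le> (real n)\<^sup>2 * h\<^sup>2"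
      by (simp add: power2_eq_square mult.assoc)
    have "(\<Sum>j\<in>{1..<r}. step (b + j)) \<le> (\<Sum>j\<in>{1..<r}. sqrt (real n) * h * (1 / sqrt (real j)))"
    proof (rule sum_mono)
      fix j assume j: "j \<in> {1..<r}"
      have "(sqrt (real j) * step (b + j))\<^sup>2 \<le> (sqrt (real n) * h)\<^sup>2"
        using reg[of j] j by (simp add: power_mult_distrib)
      then have "sqrt (real j) * step (b + j) \<le> sqrt (real n) * h"
        by (rule power2_le_imp_le) (use h in simp)
      then show "step (b + j) \<le> sqrt (real n) * h * (1 / sqrt (real j))"
        using j by (simp add: field_simps)
    qed
    also have "\<dots> \<le> (\<Sum>j=1..n. sqrt (real n) * h * (1 / sqrt (real j)))"
      using rn h by (intro sum_mono2) auto
    also have "\<dots> \<le> sqrt (real n) * h * (2 * sqrt (real n))"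
      unfolding sum_distrib_left[symmetric] using sum_inverse_sqrt_le[of n] h
      by (intro mult_left_mono) auto
    also have "\<dots> = 2 * real n * h" by simp
    finally show "(\<Sum>j\<in>{1..<r}. step (b + j)) \<le> 2 * real n * h" .
    show "real (r - 1) \<le> real n" using rn by simp
  qed (use l G12 h in auto)
  also have "\<dots> = real n * (3 * K * h + 6 * G2\<^sup>2 * h)"
  proof -
    have "((real n)\<^sup>2 * h\<^sup>2) * ?c = real n * (2 * K * h)"
    proof -
      have "((real n)\<^sup>2 * h\<^sup>2) * ?c = real n * h * (2 * G1 * G2) * (real n * (G2 * h) / l)"
        by (simp add: power2_eq_square)
      also have "real n * (G2 * h) / l = sqrt (real n)"
        using G12 h n0 unfolding l_def by (simp add: real_div_sqrt)
      finally show ?thesis by (simp add: K_def G1_def G2_def)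
    qed
    moreover have "l * G1 = K * h" by (simp add: l_def K_def G1_def G2_def)
    ultimately show ?thesis by (simp add: algebra_simps)
  qed
  also have "\<dots> \<le> real n * (9 * K * h)"
    using Gf2_sq_le_K h n0 unfolding G2_def by (intro mult_left_mono) (auto simp: mult_right_mono)
  finally have "(\<Sum>j=1..n. mean \<Omega> (\<lambda>\<omega>. G (\<omega> q r) * nrm d (X (exchange q j r \<omega>) s - X \<omega> s))) / real n
      \<le> 9 * K * h"
    using n0 by (simp add: field_simps)
  with bias_le_exchange_distance[OF t s q_def r_def]
  show ?thesis unfolding RR_index_def q_def[symmetric] r_def[symmetric] h_def by linarith
qed

end

section \<open>From the bias to the last iterate\<close>

text \<open>Let \<open>W k\<close> be the sum of the weights from \<open>k\<close> to \<open>T\<close>, and compare \<open>a T\<close> with the weighted average of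
  \<open>a k, \<dots>, a T\<close> as \<open>k\<close> decreases from \<open>T\<close> to \<open>1\<close>. Including \<open>a k\<close> changes the gap by at most
  \<open>1 / W (k + 1) - 1 / W k\<close> times the sum of \<open>r t\<close> over \<open>t > k\<close>. For a fixed \<open>t\<close> these factors telescope
  to \<open>1 / W t - 1 / W 1\<close>.\<close>

lemma last_iterate_le:
  fixes a h r :: "nat \<Rightarrow> real"
  assumes T: "1 \<le> T" and h: "\<And>t. t \<in> {1..T} \<Longrightarrow> 0 < h t"
    and later: "\<And>k. k \<in> {1..<T} \<Longrightarrow> (\<Sum>t=k+1..T. h t * (a t - a k)) \<le> (\<Sum>t=k+1..T. r t)"
    and start: "(\<Sum>t=1..T. h t * (a t - c)) \<le> D + (\<Sum>t=1..T. r t)"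
  shows "a T - c \<le> D / (\<Sum>t=1..T. h t) + (\<Sum>t=1..T. r t / (\<Sum>s=t..T. h s))"
proof -
  define W where "W k = (\<Sum>s=k..T. h s)" for k
  define A where "A k = (\<Sum>t=k..T. h t * a t)" for k
  define R where "R k = (\<Sum>t=k..T. r t)" for k
  define V where "V k = (\<Sum>t=k..T. r t / W t)" for k
  have Wpos: "0 < W k" if "1 \<le> k" "k \<le> T" for k
    unfolding W_def using that h by (intro sum_pos) auto
  have "a T - A k / W k \<le> V k - R k / W k" if "1 \<le> k" "k \<le> T" for k
    using that(2,1)
  proof (induction rule: inc_induct)
    case base
    then show ?case using h[of T] by (simp add: A_def W_def V_def R_def)
  next
    case (step k)
    then have k: "1 \<le> k" "k < T" by auto
    have hd: "W k = h k + W (k + 1)" "A k = h k * a k + A (k + 1)" "R k = r k + R (k + 1)"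
      "V k = r k / W k + V (k + 1)"
      using k by (simp_all add: W_def A_def R_def V_def sum.atLeast_Suc_atMost)
    have pos: "0 < W k" "0 < W (k + 1)" "0 < h k" using Wpos h k by auto
    have "A (k + 1) - W (k + 1) * a k \<le> R (k + 1)"
      using later[of k] k
      by (simp add: A_def W_def R_def right_diff_distrib sum_subtractf sum_distrib_right)
    then have "h k * (A (k + 1) - W (k + 1) * a k) / (W k * W (k + 1))
        \<le> h k * R (k + 1) / (W k * W (k + 1))"
      using pos by (intro divide_right_mono mult_left_mono) auto
    moreover have "h k * (A (k + 1) - W (k + 1) * a k) / (W k * W (k + 1))
        = A (k + 1) / W (k + 1) - A k / W k"
      using pos unfolding hd(2) by (simp add: divide_simps) (simp add: hd(1) algebra_simps)
    moreover have "h k * R (k + 1) / (W k * W (k + 1)) = R (k + 1) / W (k + 1) - R (k + 1) / W k"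
      using pos by (simp add: divide_simps) (simp add: hd(1) algebra_simps)
    moreover have "R k / W k = r k / W k + R (k + 1) / W k"
      by (simp add: hd(3) add_divide_distrib)
    ultimately show ?case using step.IH k hd(4) by simp
  qed
  from this[of 1] T have 1: "a T - A 1 / W 1 \<le> V 1 - R 1 / W 1" by simp
  have "A 1 - W 1 * c \<le> D + R 1"
    using start by (simp add: A_def W_def R_def right_diff_distrib sum_subtractf sum_distrib_right)
  then have "(A 1 - W 1 * c) / W 1 \<le> (D + R 1) / W 1"
    using Wpos[of 1] T by (intro divide_right_mono) auto
  then have "A 1 / W 1 - c \<le> D / W 1 + R 1 / W 1"
    using Wpos[of 1] T by (simp add: diff_divide_distrib add_divide_distrib)
  with 1 have "a T - c \<le> D / W 1 + V 1" by linarith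
  then show ?thesis by (simp add: W_def V_def)
qed

lemma ereal_expectation_cong_pmf:
  assumes "\<And>\<omega>. \<omega> \<in> set_pmf p \<Longrightarrow> Y \<omega> = Z \<omega>"
  shows "ereal_expectation (measure_pmf p) Y = ereal_expectation (measure_pmf p) Z"
proof -
  have "(\<integral>\<^sup>+\<omega>. e2ennreal (Y \<omega>) \<partial>measure_pmf p) = (\<integral>\<^sup>+\<omega>. e2ennreal (Z \<omega>) \<partial>measure_pmf p)"
    "(\<integral>\<^sup>+\<omega>. e2ennreal (- Y \<omega>) \<partial>measure_pmf p) = (\<integral>\<^sup>+\<omega>. e2ennreal (- Z \<omega>) \<partial>measure_pmf p)"
    using assms by (auto intro!: nn_integral_cong_AE AE_pmfI)
  then show ?thesis by (simp add: ereal_expectation_def)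
qed

lemma ereal_expectation_pmf_of_set:
  assumes "finite A" "A \<noteq> {}"
  shows "ereal_expectation (measure_pmf (pmf_of_set A)) (\<lambda>\<omega>. ereal (Y \<omega>)) = ereal (mean A Y)"
proof -
  have "integrable (measure_pmf (pmf_of_set A)) Y"
    using assms by (intro integrable_measure_pmf_finite) simp
  then show ?thesis
    using assms by (simp add: ereal_expectation_integrable integral_pmf_of_set mean_def)
qed

context rr_run
begin

definition mean_value :: "nat \<Rightarrow> real" where
  "mean_value s = mean \<Omega> (\<lambda>\<omega>. f_avg (X \<omega> s) + psi_val (X \<omega> s))"

text \<open>The comparison point \<open>Y \<omega>\<close> may depend on the order. The price is its own sampling bias, which
  is zero for a constant and at most \<open>9 * K * step t\<close> for an earlier iterate.\<close>

lemma mean_descent: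
  assumes Y: "\<And>\<omega>. \<omega> \<in> \<Omega> \<Longrightarrow> Y \<omega> \<in> edom d \<psi>"
    and bias: "\<And>t. t \<in> {k + 1..T} \<Longrightarrow>
      \<bar>mean \<Omega> (\<lambda>\<omega>. f_avg (Y \<omega>)) - mean \<Omega> (\<lambda>\<omega>. f (RR_index n \<omega> t) (Y \<omega>))\<bar> \<le> 9 * K * step t"
    and k: "k \<le> T"
  shows "(\<Sum>t=k+1..T. step t * (mean_value (t + 1) - mean \<Omega> (\<lambda>\<omega>. f_avg (Y \<omega>) + psi_val (Y \<omega>))))
    \<le> mean \<Omega> (\<lambda>\<omega>. (nrm d (Y \<omega> - X \<omega> (k + 1)))\<^sup>2) / 2 + (\<Sum>t=k+1..T. 20 * K * (step t)\<^sup>2)"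
proof -
  let ?dist = "\<lambda>t. mean \<Omega> (\<lambda>\<omega>. (nrm d (Y \<omega> - X \<omega> t))\<^sup>2)"
  have one: "step t * (mean_value (t + 1) - mean \<Omega> (\<lambda>\<omega>. f_avg (Y \<omega>) + psi_val (Y \<omega>)))
      \<le> (?dist t - ?dist (t + 1)) / 2 + 20 * K * (step t)\<^sup>2" if tk: "t \<in> {k + 1..T}" for t
  proof -
    have t: "t \<in> {1..T}" using tk by auto
    let ?i = "\<lambda>\<omega>. RR_index n \<omega> t"
    have "mean \<Omega> (\<lambda>\<omega>. step t * ((f (?i \<omega>) (X \<omega> (t + 1)) + psi_val (X \<omega> (t + 1))) - (f (?i \<omega>) (Y \<omega>) + psi_val (Y \<omega>))))
        \<le> mean \<Omega> (\<lambda>\<omega>. ((nrm d (Y \<omega> - X \<omega> t))\<^sup>2 - (nrm d (Y \<omega> - X \<omega> (t + 1)))\<^sup>2) / 2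
              + 2 * (step t)\<^sup>2 * (G (?i \<omega>))\<^sup>2)"
    proof (rule mean_mono)
      fix \<omega> assume w: "\<omega> \<in> \<Omega>"
      have xd: "X \<omega> t \<in> edom d \<psi>" using X_edom[OF w, of t] t by simp
      show "step t * ((f (?i \<omega>) (X \<omega> (t + 1)) + psi_val (X \<omega> (t + 1))) - (f (?i \<omega>) (Y \<omega>) + psi_val (Y \<omega>)))
          \<le> ((nrm d (Y \<omega> - X \<omega> t))\<^sup>2 - (nrm d (Y \<omega> - X \<omega> (t + 1)))\<^sup>2) / 2
              + 2 * (step t)\<^sup>2 * (G (?i \<omega>))\<^sup>2"
        by (rule prox_step_descent[OF index_range[OF w t] step_pos[OF t] xd Y[OF w]
              trajectory[OF w, unfolded prox_grad_iterates_def, THEN conjunct2, rule_format, OF t]])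
    qed
    then have 1: "step t * ((mean \<Omega> (\<lambda>\<omega>. f (?i \<omega>) (X \<omega> (t + 1))) + mean \<Omega> (\<lambda>\<omega>. psi_val (X \<omega> (t + 1))))
          - (mean \<Omega> (\<lambda>\<omega>. f (?i \<omega>) (Y \<omega>)) + mean \<Omega> (\<lambda>\<omega>. psi_val (Y \<omega>))))
        \<le> (?dist t - ?dist (t + 1)) / 2 + 2 * (step t)\<^sup>2 * mean \<Omega> (\<lambda>\<omega>. (G (?i \<omega>))\<^sup>2)"
      unfolding mean_mult_left mean_diff mean_add mean_divide .
    have G2: "mean \<Omega> (\<lambda>\<omega>. (G (?i \<omega>))\<^sup>2) = (Gf2 n G)\<^sup>2"
      unfolding RR_index_def Gf2_sq
      by (rule mean_entry[OF epoch_range[OF t] time_decomposition(2)]) (use n_pos t in auto)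
    have "mean_value (t + 1) - mean \<Omega> (\<lambda>\<omega>. f_avg (Y \<omega>) + psi_val (Y \<omega>))
        \<le> ((mean \<Omega> (\<lambda>\<omega>. f (?i \<omega>) (X \<omega> (t + 1))) + mean \<Omega> (\<lambda>\<omega>. psi_val (X \<omega> (t + 1))))
          - (mean \<Omega> (\<lambda>\<omega>. f (?i \<omega>) (Y \<omega>)) + mean \<Omega> (\<lambda>\<omega>. psi_val (Y \<omega>)))) + 18 * K * step t"
      using sampling_bias[OF t, of "t + 1"] bias[OF tk] t unfolding mean_value_def mean_add by simp
    then have "step t * (mean_value (t + 1) - mean \<Omega> (\<lambda>\<omega>. f_avg (Y \<omega>) + psi_val (Y \<omega>)))
        \<le> step t * (((mean \<Omega> (\<lambda>\<omega>. f (?i \<omega>) (X \<omega> (t + 1))) + mean \<Omega> (\<lambda>\<omega>. psi_val (X \<omega> (t + 1))))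
          - (mean \<Omega> (\<lambda>\<omega>. f (?i \<omega>) (Y \<omega>)) + mean \<Omega> (\<lambda>\<omega>. psi_val (Y \<omega>)))) + 18 * K * step t)"
      using step_pos[OF t] by (intro mult_left_mono) auto
    also have "\<dots> \<le> (?dist t - ?dist (t + 1)) / 2 + 2 * (step t)\<^sup>2 * (Gf2 n G)\<^sup>2 + 18 * K * (step t)\<^sup>2"
      using 1 unfolding G2 distrib_left[of "step t" _ "18 * K * step t"]
      by (simp add: power2_eq_square mult.assoc mult.left_commute)
    also have "\<dots> \<le> (?dist t - ?dist (t + 1)) / 2 + 20 * K * (step t)\<^sup>2"
      using mult_left_mono[OF Gf2_sq_le_K, of "2 * (step t)\<^sup>2"] by (simp add: algebra_simps)
    finally show ?thesis .
  qed
  have "(\<Sum>t=k+1..T. step t * (mean_value (t + 1) - mean \<Omega> (\<lambda>\<omega>. f_avg (Y \<omega>) + psi_val (Y \<omega>))))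
      \<le> (\<Sum>t=k+1..T. (?dist t - ?dist (t + 1)) / 2 + 20 * K * (step t)\<^sup>2)"
    by (rule sum_mono[OF one])
  also have "\<dots> = (?dist (k + 1) - ?dist (T + 1)) / 2 + (\<Sum>t=k+1..T. 20 * K * (step t)\<^sup>2)"
  proof -
    have "(\<Sum>t=k+1..T. ?dist t - ?dist (t + 1)) = ?dist (k + 1) - ?dist (T + 1)"
      using sum_Suc_diff[of "k + 1" T "\<lambda>t. - ?dist t"] k by simp
    then show ?thesis unfolding sum.distrib sum_divide_distrib[symmetric] by simp
  qed
  also have "\<dots> \<le> ?dist (k + 1) / 2 + (\<Sum>t=k+1..T. 20 * K * (step t)\<^sup>2)"
  proof -
    have "0 \<le> ?dist (T + 1)" unfolding mean_def by (intro divide_nonneg_nonneg sum_nonneg) auto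
    then show ?thesis by simp
  qed
  finally show ?thesis .
qed

lemma mean_value_last_le:
  assumes z: "z \<in> edom d \<psi>"
  shows "mean_value (T + 1) - (f_avg z + psi_val z)
    \<le> (nrm d (z - x1))\<^sup>2 / 2 / (\<Sum>t=1..T. step t)
      + (\<Sum>t=1..T. 20 * K * (step t)\<^sup>2 / (\<Sum>s=t..T. step s))"
proof (rule last_iterate_le[where a = "\<lambda>t. mean_value (t + 1)", OF T_pos step_pos])
  fix k assume k: "k \<in> {1..<T}"
  have "(\<Sum>t=k+1..T. step t * (mean_value (t + 1) - mean_value (k + 1)))
      \<le> mean \<Omega> (\<lambda>\<omega>. (nrm d (X \<omega> (k + 1) - X \<omega> (k + 1)))\<^sup>2) / 2 + (\<Sum>t=k+1..T. 20 * K * (step t)\<^sup>2)"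
    unfolding mean_value_def[of "k + 1"]
  proof (rule mean_descent)
    show "X \<omega> (k + 1) \<in> edom d \<psi>" if "\<omega> \<in> \<Omega>" for \<omega> using X_edom[OF that] k by simp
    show "\<bar>mean \<Omega> (\<lambda>\<omega>. f_avg (X \<omega> (k + 1))) - mean \<Omega> (\<lambda>\<omega>. f (RR_index n \<omega> t) (X \<omega> (k + 1)))\<bar>
        \<le> 9 * K * step t" if "t \<in> {k + 1..T}" for t
      using that k by (intro sampling_bias) auto
  qed (use k in simp)
  then show "(\<Sum>t=k+1..T. step t * (mean_value (t + 1) - mean_value (k + 1)))
      \<le> (\<Sum>t=k+1..T. 20 * K * (step t)\<^sup>2)"
    by (simp add: nrm_def L2_set_def mean_def)
next
  note const = mean_const[OF finite_RR_orders RR_orders_nonempty]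
  have "(\<Sum>t=0+1..T. step t * (mean_value (t + 1) - mean \<Omega> (\<lambda>\<omega>. f_avg z + psi_val z)))
      \<le> mean \<Omega> (\<lambda>\<omega>. (nrm d (z - X \<omega> (0 + 1)))\<^sup>2) / 2 + (\<Sum>t=0+1..T. 20 * K * (step t)\<^sup>2)"
  proof (rule mean_descent)
    fix t assume "t \<in> {0 + 1..T}"
    then have t: "t \<in> {1..T}" by simp
    have "mean \<Omega> (\<lambda>\<omega>. f (RR_index n \<omega> t) z) = f_avg z"
      unfolding RR_index_def f_avg_def
      by (rule mean_entry[OF epoch_range[OF t] time_decomposition(2)]) (use n_pos t in auto)
    then show "\<bar>mean \<Omega> (\<lambda>\<omega>. f_avg z) - mean \<Omega> (\<lambda>\<omega>. f (RR_index n \<omega> t) z)\<bar> \<le> 9 * K * step t"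
      using K_pos step_pos[OF t] by (simp add: const)
  qed (use z in auto)
  moreover have "mean \<Omega> (\<lambda>\<omega>. (nrm d (z - X \<omega> (0 + 1)))\<^sup>2) = mean \<Omega> (\<lambda>\<omega>. (nrm d (z - x1))\<^sup>2)"
    using trajectory by (intro mean_cong) (simp add: prox_grad_iterates_def)
  ultimately show "(\<Sum>t=1..T. step t * (mean_value (t + 1) - (f_avg z + psi_val z)))
      \<le> (nrm d (z - x1))\<^sup>2 / 2 + (\<Sum>t=1..T. 20 * K * (step t)\<^sup>2)"
    by (simp add: const)
qed

lemma objective_eq: "x \<in> edom d \<psi> \<Longrightarrow> objective n f \<psi> x = ereal (f_avg x + psi_val x)"
  by (simp add: objective_def f_avg_def psi_val)

lemma expected_gap_le:
  assumes z: "z \<in> Rd d"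
  shows "expected_gap n T f \<psi> X z
    \<le> ereal ((nrm d (z - x1))\<^sup>2 / 2 / (\<Sum>t=1..T. step t)
        + (\<Sum>t=1..T. 20 * K * (step t)\<^sup>2 / (\<Sum>s=t..T. step s)))"
proof (cases "z \<in> edom d \<psi>")
  case True
  have "expected_gap n T f \<psi> X z = ereal_expectation (measure_pmf (pmf_of_set \<Omega>))
      (\<lambda>\<omega>. ereal ((f_avg (X \<omega> (T + 1)) + psi_val (X \<omega> (T + 1))) - (f_avg z + psi_val z)))"
    unfolding expected_gap_def RR_pmf_eq
  proof (rule ereal_expectation_cong_pmf)
    fix \<omega> assume "\<omega> \<in> set_pmf (pmf_of_set \<Omega>)"
    then have "\<omega> \<in> \<Omega>" by (simp add: finite_RR_orders RR_orders_nonempty)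
    then show "objective n f \<psi> (X \<omega> (T + 1)) - objective n f \<psi> z
        = ereal ((f_avg (X \<omega> (T + 1)) + psi_val (X \<omega> (T + 1))) - (f_avg z + psi_val z))"
      using X_edom[of \<omega> "T + 1"] True by (simp add: objective_eq)
  qed
  also have "\<dots> = ereal (mean_value (T + 1) - (f_avg z + psi_val z))"
    unfolding ereal_expectation_pmf_of_set[OF finite_RR_orders RR_orders_nonempty] mean_value_def
    by (simp only: mean_diff mean_const[OF finite_RR_orders RR_orders_nonempty])
  finally show ?thesis using mean_value_last_le[OF True] by simp
next
  case False
  \<comment> \<open>here the gap is \<open>- \<infinity>\<close> for every order, and so is its expectation\<close>
  then have "\<psi> z = \<infinity>" using z by (simp add: edom_def)
  then have "objective n f \<psi> z = \<infinity>" by (simp add: objective_def)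
  then have "expected_gap n T f \<psi> X z
      = ereal_expectation (measure_pmf (RR_pmf n (epoch n T))) (\<lambda>\<omega>. - \<infinity>)"
    unfolding expected_gap_def
  proof (intro ereal_expectation_cong_pmf)
    fix \<omega> assume "\<omega> \<in> set_pmf (RR_pmf n (epoch n T))"
    then have "X \<omega> (T + 1) \<in> edom d \<psi>" by (intro X_edom) (auto simp: set_RR_pmf)
    with \<open>objective n f \<psi> z = \<infinity>\<close>
    show "objective n f \<psi> (X \<omega> (T + 1)) - objective n f \<psi> z = - \<infinity>"
      by (simp add: objective_eq)
  qed
  also have "\<dots> = - \<infinity>"
    by (simp add: ereal_expectation_def e2ennreal_neg zero_ennreal.rep_eq)
  finally show ?thesis by simp
qed

end

section \<open>The three step size rules\<close>

lemma sum_inverse_le: "1 \<le> T \<Longrightarrow> (\<Sum>t=1..T. 1 / real t) \<le> 1 + ln (real T)"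
proof (induction T rule: dec_induct)
  case (step T)
  have "ln (real T / real (Suc T)) \<le> real T / real (Suc T) - 1"
    using step by (intro ln_le_minus_one) auto
  then have "1 / real (Suc T) \<le> ln (real (Suc T)) - ln (real T)"
    using step by (simp add: ln_div field_simps)
  then show ?case using step by simp
qed simp

lemma sum_inverse_remaining_le:
  assumes "1 \<le> T"
  shows "(\<Sum>t=1..T. 1 / real (T + 1 - t)) \<le> 1 + ln (real T)"
  using sum_inverse_le[OF assms] sum.atLeastAtMost_rev[of "\<lambda>t. 1 / real t" 1 T] by simp

lemma le_mult_self: "0 \<le> x \<Longrightarrow> 1 \<le> c \<Longrightarrow> x \<le> c * x" for x c :: real
  using mult_right_mono[of 1 c x] by simp

lemma div_sqrt_mult: "c / sqrt (real T) * real T = c * sqrt (real T)"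
proof -
  have "c / sqrt (real T) * real T = c * (real T / sqrt (real T))" by simp
  also have "real T / sqrt (real T) = sqrt (real T)" by (rule real_div_sqrt) simp
  finally show ?thesis .
qed

lemma rr_runI:
  assumes "composite_problem d n f g G \<psi>" "1 \<le> T" "x1 \<in> edom d \<psi>"
    and "\<And>t. t \<in> {1..T} \<Longrightarrow> 0 < step t"
    and "\<And>t k. t \<in> {1..T} \<Longrightarrow> k \<in> {1..pos_in_epoch n t} \<Longrightarrow>
       real k * (step ((epoch n t - 1) * n + k))\<^sup>2 \<le> real n * (step t)\<^sup>2"
    and "RR_iterates d n T g \<psi> step x1 X"
  shows "rr_run d n f g G \<psi> T step x1 X"
  using assms by (intro rr_run.intro rr_run_axioms.intro) auto

text \<open>All three rules reduce to two sums: the total step length, by which the initial squared distance is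
  divided, and the squared steps weighted by the inverse of the remaining step length.\<close>

lemma gap_from_step_sums:
  assumes run: "rr_run d n f g G \<psi> T step x1 X" and z: "z \<in> Rd d" and \<eta>: "0 < \<eta>"
    and total: "\<eta> * sqrt (real T) / 2 \<le> (\<Sum>t=1..T. step t)"
    and weights: "(\<Sum>t=1..T. (step t)\<^sup>2 / (\<Sum>s=t..T. step s)) \<le> 6 * (\<eta> * L / sqrt (real T))"
  shows "expected_gap n T f \<psi> X z \<le> ereal (120 * (((nrm d (z - x1))\<^sup>2 / \<eta>
           + \<eta> * sqrt (real n) * Gf1 n G * Gf2 n G * L) * (1 / sqrt (real T))))"
proof -
  interpret rr_run d n f g G \<psi> T step x1 X by (rule run)
  let ?s = "sqrt (real T)"
  have s: "0 < ?s" using T_pos by simp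
  let ?N = "(nrm d (z - x1))\<^sup>2"
  have "?N / 2 / (\<Sum>t=1..T. step t) \<le> ?N / 2 / (\<eta> * ?s / 2)"
    by (rule frac_le[OF _ order_refl _ total]) (use s \<eta> in simp_all)
  also have "\<dots> = ?N / \<eta> * (1 / ?s)" by simp
  also have "\<dots> \<le> 120 * (?N / \<eta> * (1 / ?s))"
    by (rule le_mult_self) (use s \<eta> in simp_all)
  finally have 1: "?N / 2 / (\<Sum>t=1..T. step t) \<le> 120 * (?N / \<eta> * (1 / ?s))" .
  have "(\<Sum>t=1..T. 20 * K * (step t)\<^sup>2 / (\<Sum>s=t..T. step s))
      = 20 * K * (\<Sum>t=1..T. (step t)\<^sup>2 / (\<Sum>s=t..T. step s))"
    by (simp add: sum_distrib_left)
  also have "\<dots> \<le> 20 * K * (6 * (\<eta> * L / ?s))"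
    using K_pos weights by (intro mult_left_mono) auto
  also have "\<dots> = 120 * (\<eta> * sqrt (real n) * Gf1 n G * Gf2 n G * L * (1 / ?s))"
    by (simp add: K_def)
  finally have 2: "(\<Sum>t=1..T. 20 * K * (step t)\<^sup>2 / (\<Sum>s=t..T. step s))
      \<le> 120 * (\<eta> * sqrt (real n) * Gf1 n G * Gf2 n G * L * (1 / ?s))" .
  show ?thesis
    using order_trans[OF expected_gap_le[OF z]] 1 2 by (simp only: distrib_left distrib_right ereal_less_eq)
qed

text \<open>Pairing \<open>s\<close> with \<open>T + t - s\<close> shows that the average number of remaining epochs over
  \<open>{t..T}\<close> is at least half of that at \<open>t\<close>.\<close>

lemma remaining_epochs_sum_ge:
  assumes n: "1 \<le> n" and t: "t \<in> {1..T}"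
  shows "real (T + 1 - t) * (real (epoch n T) - real (epoch n t) + 1) / 2
    \<le> (\<Sum>s=t..T. real (epoch n T) - real (epoch n s) + 1)"
proof -
  let ?p = "\<lambda>s. real (epoch n T) - real (epoch n s) + 1"
  have "(\<Sum>s=t..T. ?p t) \<le> (\<Sum>s=t..T. ?p s + ?p (T + t - s))"
  proof (rule sum_mono)
    fix s assume s: "s \<in> {t..T}"
    have split: "a div n + b div n \<le> (a + b) div n" "(a + b) div n \<le> a div n + b div n + 1" for a b
    proof -
      have "a mod n < n" "b mod n < n" using n by simp_all
      then have "a mod n + b mod n < 2 * n" by linarith
      then have "(a mod n + b mod n) div n < 2" by (rule less_mult_imp_div_less)
      then show "a div n + b div n \<le> (a + b) div n" "(a + b) div n \<le> a div n + b div n + 1"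
        by (simp_all add: div_add1_eq[of a b n])
    qed
    have "(s - 1) div n + (T + t - s - 1) div n \<le> (s - 1 + (T + t - s - 1)) div n"
      by (rule split)
    also have "s - 1 + (T + t - s - 1) = (T - 1) + (t - 1)" using s t by auto
    also have "\<dots> div n \<le> (T - 1) div n + (t - 1) div n + 1" by (rule split)
    finally have "(s - 1) div n + (T + t - s - 1) div n \<le> (T - 1) div n + (t - 1) div n + 1" .
    then have "epoch n s + epoch n (T + t - s) \<le> epoch n T + epoch n t + 1"
    proof -
      have "1 \<le> s" "1 \<le> T + t - s" "1 \<le> T" "1 \<le> t" using s t by auto
      from this(1-4)[THEN epoch_eq[OF n]] show ?thesis
        using \<open>(s - 1) div n + (T + t - s - 1) div n \<le> (T - 1) div n + (t - 1) div n + 1\<close> by linarith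
    qed
    then have "real (epoch n s + epoch n (T + t - s)) \<le> real (epoch n T + epoch n t + 1)"
      by (rule of_nat_mono)
    then show "?p t \<le> ?p s + ?p (T + t - s)" by simp
  qed
  also have "\<dots> = (\<Sum>s=t..T. ?p s) + (\<Sum>s=t..T. ?p (T + t - s))" by (rule sum.distrib)
  also have "(\<Sum>s=t..T. ?p (T + t - s)) = (\<Sum>s=t..T. ?p s)"
    by (rule sum.atLeastAtMost_rev[symmetric])
  finally show ?thesis by simp
qed

lemma remaining_epochs_le:
  assumes n: "1 \<le> n" and t: "t \<in> {1..T}"
  shows "real (epoch n T) - real (epoch n t) + 1 \<le> real (T + 1 - t) / real n + 2"
proof -
  have T: "(T - 1) mod n + (T - 1) div n * n = T - 1" "(t - 1) mod n + (t - 1) div n * n = t - 1" by simp_all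
  have m: "(t - 1) mod n < n" using n by simp
  have "(T - 1) div n * n \<le> (T + 1 - t) + ((t - 1) div n + 1) * n"
  proof -
    have "A \<le> (T + 1 - t) + (B + n)"
      if "x + A = T - 1" "y + B = t - 1" "y < n" "1 \<le> t" "t \<le> T" for A B x y :: nat
      using that by arith
    from this[OF T m] t show ?thesis by simp
  qed
  then have "real ((T - 1) div n * n) \<le> real ((T + 1 - t) + ((t - 1) div n + 1) * n)"
    by (rule of_nat_mono)
  then have "real ((T - 1) div n) * real n \<le> real (T + 1 - t) + (real ((t - 1) div n) + 1) * real n"
    by (simp del: of_nat_diff add: distrib_right)
  then have "real ((T - 1) div n) \<le> real (T + 1 - t) / real n + real ((t - 1) div n) + 1"
    using n by (simp add: field_simps)
  then show ?thesis using n t by (simp add: epoch_eq)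
qed

text \<open>With \<open>u\<close> steps remaining at \<open>t\<close>, the step is \<open>h * p t\<close> and the remaining length is at least
  \<open>h * u * p t / 2\<close>, so the weighted squared step is at most \<open>2 * h * p t / u\<close>. As \<open>p t \<le> u / n + 2\<close>,
  only a harmonic sum without the factor \<open>p t\<close> remains.\<close>

lemma gap_linear_steps:
  assumes prob: "composite_problem d n f g G \<psi>" and T: "1 \<le> T" and \<eta>: "0 < \<eta>"
    and x1: "x1 \<in> edom d \<psi>" and z: "z \<in> Rd d"
    and run: "RR_iterates d n T g \<psi>
      (\<lambda>t. \<eta> * ((real (epoch n T) - real (epoch n t) + 1) / (real (epoch n T) * sqrt (real T)))) x1 X"
  shows "expected_gap n T f \<psi> X z \<le> ereal (120 * (((nrm d (z - x1))\<^sup>2 / \<eta>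
           + \<eta> * sqrt (real n) * Gf1 n G * Gf2 n G * (1 + ln (real n) / real (epoch n T)))
           * (1 / sqrt (real T))))"
proof -
  interpret composite_problem d n f g G \<psi> by (rule prob)
  define Q where "Q = real (epoch n T)"
  define p where "p t = Q - real (epoch n t) + 1" for t
  define h where "h = \<eta> / (Q * sqrt (real T))"
  define step where "step t = h * p t" for t
  have step_eq: "(\<lambda>t. \<eta> * ((real (epoch n T) - real (epoch n t) + 1) / (real (epoch n T) * sqrt (real T)))) = step"
    by (simp add: fun_eq_iff step_def h_def p_def Q_def)
  have Q: "1 \<le> Q" using time_decomposition(3)[OF n_pos T] by (simp add: Q_def)
  have s: "0 < sqrt (real T)" using T by simp
  have h: "0 < h" using Q s \<eta> by (simp add: h_def)
  have hQ: "h * Q = \<eta> / sqrt (real T)" using Q by (simp add: h_def)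
  have p: "1 \<le> p t" if "t \<in> {1..T}" for t
    using epoch_mono[OF n_pos, of t T] that by (simp add: p_def Q_def)
  have W: "h * (real (T + 1 - t) * p t / 2) \<le> (\<Sum>s=t..T. step s)" if "t \<in> {1..T}" for t
    using remaining_epochs_sum_ge[OF n_pos that] h
    unfolding step_def sum_distrib_left[symmetric] p_def Q_def by (intro mult_left_mono) auto
  have "rr_run d n f g G \<psi> T step x1 X"
  proof (rule rr_runI[OF prob T x1 _ _ run[unfolded step_eq]])
    show "0 < step t" if "t \<in> {1..T}" for t using p[OF that] h by (simp add: step_def)
    fix t k assume t: "t \<in> {1..T}" and k: "k \<in> {1..pos_in_epoch n t}"
    have k': "k \<in> {1..n}" using k time_decomposition(2)[OF n_pos, of t] t by auto
    then have "step ((epoch n t - 1) * n + k) = step t"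
      using epoch_at(1)[OF _ k', of "epoch n t"] time_decomposition(3)[OF n_pos, of t] t
      by (simp add: step_def p_def)
    then show "real k * (step ((epoch n t - 1) * n + k))\<^sup>2 \<le> real n * (step t)\<^sup>2"
      using k' by (simp add: mult_right_mono)
  qed
  then show ?thesis
    unfolding Q_def[symmetric]
  proof (rule gap_from_step_sums[OF _ z \<eta>])
    have "epoch n 1 = 1" using epoch_eq[OF n_pos, of 1] by simp
    then have "p 1 = Q" by (simp add: p_def)
    then have "h * (real T * Q / 2) \<le> (\<Sum>t=1..T. step t)" using W[of 1] T by simp
    moreover have "h * (real T * Q / 2) = h * Q * real T / 2" by simp
    moreover have "\<dots> = \<eta> * sqrt (real T) / 2" unfolding hQ div_sqrt_mult ..
    ultimately show "\<eta> * sqrt (real T) / 2 \<le> (\<Sum>t=1..T. step t)" by simp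
    have "(\<Sum>t=1..T. (step t)\<^sup>2 / (\<Sum>s=t..T. step s))
        \<le> (\<Sum>t=1..T. 2 * h * (1 / real n + 2 * (1 / real (T + 1 - t))))"
    proof (rule sum_mono)
      fix t assume t: "t \<in> {1..T}"
      let ?u = "real (T + 1 - t)"
      have u: "0 < ?u" using t by simp
      have pt: "0 < p t" using p[OF t] by simp
      have d: "0 < h * (?u * p t / 2)" using h u pt by simp
      have "(step t)\<^sup>2 / (\<Sum>s=t..T. step s) \<le> (step t)\<^sup>2 / (h * (?u * p t / 2))"
        by (rule frac_le[OF zero_le_power2 order_refl d W[OF t]])
      also have "\<dots> = 2 * h * (p t / ?u)"
        using h u pt unfolding step_def by (simp add: power2_eq_square)
      also have "p t / ?u \<le> (?u / real n + 2) / ?u"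
        using remaining_epochs_le[OF n_pos t] u unfolding p_def Q_def by (intro divide_right_mono) auto
      also have "(?u / real n + 2) / ?u = 1 / real n + 2 * (1 / ?u)"
        using u by (simp add: add_divide_distrib)
      finally show "(step t)\<^sup>2 / (\<Sum>s=t..T. step s) \<le> 2 * h * (1 / real n + 2 * (1 / ?u))"
        using h by simp
    qed
    also have "\<dots> = 2 * h * (real T / real n + 2 * (\<Sum>t=1..T. 1 / real (T + 1 - t)))"
      unfolding sum_distrib_left[symmetric] sum.distrib by simp
    also have "\<dots> \<le> 2 * h * (3 * (Q + ln (real n)))"
    proof (intro mult_left_mono)
      have "T \<le> epoch n T * n"
      proof -
        have "T = (epoch n T - 1) * n + pos_in_epoch n T" "pos_in_epoch n T \<le> n" "1 \<le> epoch n T"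
          using time_decomposition[OF n_pos T] by auto
        then have "T \<le> (epoch n T - 1) * n + n" by linarith
        also have "\<dots> = epoch n T * n" using \<open>1 \<le> epoch n T\<close> by (simp add: algebra_simps)
        finally show ?thesis .
      qed
      then have TQ: "real T \<le> Q * real n"
        unfolding Q_def of_nat_mult[symmetric] of_nat_le_iff .
      have n0: "0 < real n" using n_pos by simp
      \<comment> \<open>\<open>h\<close> carries the factor \<open>1 / Q\<close>, so the part \<open>ln Q\<close> of the logarithm costs only a constant\<close>
      have "ln (real T) \<le> ln (Q * real n)" using TQ T by simp
      also have "\<dots> = ln Q + ln (real n)" using Q n0 by (intro ln_mult_pos) auto
      also have "\<dots> \<le> Q - 1 + ln (real n)" using ln_le_minus_one[of Q] Q by simp
      finally have "(\<Sum>t=1..T. 1 / real (T + 1 - t)) \<le> Q + ln (real n)"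
        using sum_inverse_remaining_le[OF T] by simp
      moreover have "real T / real n \<le> Q" using TQ n0 by (simp add: field_simps)
      moreover have "0 \<le> ln (real n)" using n_pos by simp
      moreover have "a + 2 * b \<le> 3 * (Q + l)" if "b \<le> Q + l" "a \<le> Q" "0 \<le> l" for a b l
        using that by (simp add: distrib_left)
      ultimately show "real T / real n + 2 * (\<Sum>t=1..T. 1 / real (T + 1 - t)) \<le> 3 * (Q + ln (real n))"
        by blast
    qed (use h in auto)
    also have "\<dots> = 6 * (h * Q * (1 + ln (real n) / Q))"
      using Q by (simp add: field_simps)
    also have "\<dots> = 6 * (\<eta> * (1 + ln (real n) / Q) / sqrt (real T))"
      unfolding hQ by simp
    finally show "(\<Sum>t=1..T. (step t)\<^sup>2 / (\<Sum>s=t..T. step s))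
        \<le> 6 * (\<eta> * (1 + ln (real n) / Q) / sqrt (real T))" .
  qed
qed

lemma gap_constant_steps:
  assumes prob: "composite_problem d n f g G \<psi>" and T: "1 \<le> T" and \<eta>: "0 < \<eta>"
    and x1: "x1 \<in> edom d \<psi>" and z: "z \<in> Rd d"
    and run: "RR_iterates d n T g \<psi> (\<lambda>t. \<eta> / sqrt (real T)) x1 X"
  shows "expected_gap n T f \<psi> X z \<le> ereal (120 * (((nrm d (z - x1))\<^sup>2 / \<eta>
           + \<eta> * sqrt (real n) * Gf1 n G * Gf2 n G * (1 + ln (real T))) * (1 / sqrt (real T))))"
proof (rule gap_from_step_sums[OF rr_runI[OF prob T x1 _ _ run] z \<eta>])
  interpret composite_problem d n f g G \<psi> by (rule prob)
  let ?h = "\<eta> / sqrt (real T)"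
  have h: "0 < ?h" using T \<eta> by simp
  then show "0 < ?h" .
  fix t k assume t: "t \<in> {1..T}" and k: "k \<in> {1..pos_in_epoch n t}"
  then have "k \<le> n" using time_decomposition(2)[OF n_pos, of t] by auto
  then show "real k * ?h\<^sup>2 \<le> real n * ?h\<^sup>2" by (intro mult_right_mono) auto
next
  let ?h = "\<eta> / sqrt (real T)"
  have h: "0 < ?h" using T \<eta> by simp
  have "(\<Sum>t=1..T. ?h) = \<eta> * sqrt (real T)" using div_sqrt_mult[of \<eta> T] by (simp add: mult.commute)
  then show "\<eta> * sqrt (real T) / 2 \<le> (\<Sum>t=1..T. ?h)" using \<eta> by simp
  have "(\<Sum>t=1..T. ?h\<^sup>2 / (\<Sum>s=t..T. ?h)) = (\<Sum>t=1..T. ?h * (1 / real (T + 1 - t)))"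
  proof (intro sum.cong refl)
    fix t
    have "c\<^sup>2 / (m * c) = c * (1 / m)" if "0 < c" for c m :: real
      using that by (simp add: power2_eq_square)
    from this[OF h] show "?h\<^sup>2 / (\<Sum>s=t..T. ?h) = ?h * (1 / real (T + 1 - t))" by simp
  qed
  also have "\<dots> \<le> ?h * (1 + ln (real T))"
    unfolding sum_distrib_left[symmetric]
    using sum_inverse_remaining_le[OF T] h by (intro mult_left_mono) auto
  also have "\<dots> \<le> 6 * (?h * (1 + ln (real T)))" 
    by (rule le_mult_self) (use h T in \<open>simp_all del: times_divide_eq_left\<close>)
  finally show "(\<Sum>t=1..T. ?h\<^sup>2 / (\<Sum>s=t..T. ?h)) \<le> 6 * (\<eta> * (1 + ln (real T)) / sqrt (real T))"
    by simp
qed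

text \<open>The steps from \<open>t\<close> to \<open>T\<close> are at least \<open>\<eta> / sqrt T\<close>, and partial fractions split
  \<open>1 / (t * (T + 1 - t))\<close> into two harmonic sums, with the factor \<open>1 / (T + 1)\<close>.\<close>

lemma gap_decreasing_steps:
  assumes prob: "composite_problem d n f g G \<psi>" and T: "1 \<le> T" and \<eta>: "0 < \<eta>"
    and x1: "x1 \<in> edom d \<psi>" and z: "z \<in> Rd d"
    and run: "RR_iterates d n T g \<psi> (\<lambda>t. \<eta> / sqrt (real t)) x1 X"
  shows "expected_gap n T f \<psi> X z \<le> ereal (120 * (((nrm d (z - x1))\<^sup>2 / \<eta>
           + \<eta> * sqrt (real n) * Gf1 n G * Gf2 n G * (1 + ln (real T))) * (1 / sqrt (real T))))"
proof (rule gap_from_step_sums[OF rr_runI[OF prob T x1 _ _ run] z \<eta>])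
  interpret composite_problem d n f g G \<psi> by (rule prob)
  show "0 < \<eta> / sqrt (real t)" if "t \<in> {1..T}" for t using that \<eta> by simp
  fix t k assume t: "t \<in> {1..T}" and k: "k \<in> {1..pos_in_epoch n t}"
  define b where "b = (epoch n t - 1) * n"
  define r where "r = pos_in_epoch n t"
  have r: "r \<in> {1..n}" and tb: "t = b + r"
    using time_decomposition[OF n_pos, of t] t by (auto simp: b_def r_def)
  have k': "1 \<le> k" "k \<le> r" using k by (auto simp: r_def)
  have "k * b + k * r \<le> n * b + k * n" using k' r by (intro add_mono mult_le_mono) auto
  then have "k * (b + r) \<le> n * (b + k)" by (simp add: algebra_simps)
  then have "real k * real (b + r) \<le> real n * real (b + k)"
    unfolding of_nat_mult[symmetric] of_nat_le_iff .
  then have "real k / real (b + k) \<le> real n / real (b + r)"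
    using k' by (simp add: divide_simps mult.commute)
  then have "\<eta>\<^sup>2 * (real k / real (b + k)) \<le> \<eta>\<^sup>2 * (real n / real (b + r))"
    by (intro mult_left_mono) auto
  then show "real k * (\<eta> / sqrt (real ((epoch n t - 1) * n + k)))\<^sup>2 \<le> real n * (\<eta> / sqrt (real t))\<^sup>2"
    unfolding b_def[symmetric] unfolding tb by (simp add: power_divide mult.commute)
next
  let ?s = "sqrt (real T)"
  have s: "0 < ?s" using T by simp
  have W: "real (T + 1 - t) * (\<eta> / ?s) \<le> (\<Sum>s=t..T. \<eta> / sqrt (real s))" if "t \<in> {1..T}" for t
  proof -
    have "(\<Sum>s=t..T. \<eta> / ?s) \<le> (\<Sum>s=t..T. \<eta> / sqrt (real s))"
      using that \<eta> by (intro sum_mono divide_left_mono) auto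
    then show ?thesis by simp
  qed
  have "real T * (\<eta> / ?s) = \<eta> * ?s" using div_sqrt_mult[of \<eta> T] by (simp add: mult.commute)
  then have "\<eta> * ?s \<le> (\<Sum>t=1..T. \<eta> / sqrt (real t))"
    using W[of 1] T by simp
  then show "\<eta> * ?s / 2 \<le> (\<Sum>t=1..T. \<eta> / sqrt (real t))"
    using mult_pos_pos[OF \<eta> s] by linarith
  have "(\<Sum>t=1..T. (\<eta> / sqrt (real t))\<^sup>2 / (\<Sum>s=t..T. \<eta> / sqrt (real s)))
      \<le> (\<Sum>t=1..T. \<eta> / ?s * (1 / real t + 1 / real (T + 1 - t)))"
  proof (rule sum_mono)
    fix t assume t: "t \<in> {1..T}"
    let ?u = "real (T + 1 - t)"
    have u: "0 < ?u" "0 < real t" "?u + real t = real T + 1" using t by (auto simp: of_nat_diff)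
    have d: "0 < ?u * (\<eta> / ?s)" using u \<eta> s by simp
    have "(\<eta> / sqrt (real t))\<^sup>2 / (\<Sum>s=t..T. \<eta> / sqrt (real s)) \<le> (\<eta> / sqrt (real t))\<^sup>2 / (?u * (\<eta> / ?s))"
      by (rule frac_le[OF zero_le_power2 order_refl d W[OF t]])
    also have "\<dots> = \<eta> * ?s * (1 / (real t * ?u))"
      using u \<eta> s by (simp add: power_divide power2_eq_square)
    also have "\<dots> = \<eta> / ?s * (real T * (1 / (real t * ?u)))"
      by (simp only: div_sqrt_mult mult.assoc[symmetric])
    also have "\<dots> \<le> \<eta> / ?s * ((?u + real t) * (1 / (real t * ?u)))"
      using u \<eta> s by (intro mult_left_mono mult_right_mono) auto
    also have "(?u + real t) * (1 / (real t * ?u)) = 1 / real t + 1 / ?u"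
      using u(1,2) by (simp add: divide_simps)
    finally show "(\<eta> / sqrt (real t))\<^sup>2 / (\<Sum>s=t..T. \<eta> / sqrt (real s)) \<le> \<eta> / ?s * (1 / real t + 1 / ?u)" .
  qed
  also have "\<dots> = \<eta> / ?s * ((\<Sum>t=1..T. 1 / real t) + (\<Sum>t=1..T. 1 / real (T + 1 - t)))"
    unfolding sum_distrib_left[symmetric] sum.distrib ..
  also have "\<dots> \<le> \<eta> / ?s * (6 * (1 + ln (real T)))"
  proof (rule mult_left_mono)
    have "0 \<le> ln (real T)" using T by simp
    then show "(\<Sum>t=1..T. 1 / real t) + (\<Sum>t=1..T. 1 / real (T + 1 - t)) \<le> 6 * (1 + ln (real T))"
      using sum_inverse_le[OF T] sum_inverse_remaining_le[OF T] by (simp add: distrib_left)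
  qed (use \<eta> s in simp)
  also have "\<dots> = 6 * (\<eta> * (1 + ln (real T)) / ?s)"
  proof -
    have "\<eta> / ?s * (6 * c) = 6 * (\<eta> * c / ?s)" for c by simp
    then show ?thesis .
  qed
  finally show "(\<Sum>t=1..T. (\<eta> / sqrt (real t))\<^sup>2 / (\<Sum>s=t..T. \<eta> / sqrt (real s)))
      \<le> 6 * (\<eta> * (1 + ln (real T)) / ?s)" .
qed

theorem theoremA1:
  shows "\<exists>C>0::real.
    \<forall>(d::nat) (n::nat) f g G \<psi> (T::nat) (\<eta>::real) x1 X.
      composite_problem d n f g G \<psi> \<longrightarrow> 1 \<le> T \<longrightarrow> 0 < \<eta> \<longrightarrow> x1 \<in> edom d \<psi> \<longrightarrow>
      (RR_iterates d n T g \<psi>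
         (\<lambda>t. \<eta> * ((real (epoch n T) - real (epoch n t) + 1) / (real (epoch n T) * sqrt (real T))))
         x1 X \<longrightarrow>
       (\<forall>z\<in>Rd d. expected_gap n T f \<psi> X z
          \<le> ereal (C * (((nrm d (z - x1))\<^sup>2 / \<eta>
               + \<eta> * sqrt (real n) * Gf1 n G * Gf2 n G * (1 + ln (real n) / real (epoch n T)))
               * (1 / sqrt (real T))))))
      \<and>
      (RR_iterates d n T g \<psi> (\<lambda>t. \<eta> / sqrt (real T)) x1 X \<longrightarrow>
       (\<forall>z\<in>Rd d. expected_gap n T f \<psi> X z
          \<le> ereal (C * (((nrm d (z - x1))\<^sup>2 / \<eta>
               + \<eta> * sqrt (real n) * Gf1 n G * Gf2 n G * (1 + ln (real T)))
               * (1 / sqrt (real T))))))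
      \<and>
      (RR_iterates d n T g \<psi> (\<lambda>t. \<eta> / sqrt (real t)) x1 X \<longrightarrow>
       (\<forall>z\<in>Rd d. expected_gap n T f \<psi> X z
          \<le> ereal (C * (((nrm d (z - x1))\<^sup>2 / \<eta>
               + \<eta> * sqrt (real n) * Gf1 n G * Gf2 n G * (1 + ln (real T)))
               * (1 / sqrt (real T))))))"
  using gap_linear_steps gap_constant_steps gap_decreasing_steps
  by (intro exI[of _ 120] conjI allI impI ballI) simp_all

end
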